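(* Suppose that $f,g\in\mathcal{B}$ are affinely equivalent. Then $\operatorname{edim}(f)=\operatorname{edim}(g)$.
   Context: A transcendental entire function is an entire function $f:\mathbb{C}\to\mathbb{C}$ that is not a polynomial. The set $\operatorname{sing}(f^{-1})$ consists of the (finite) critical and asymptotic values of $f$. The Eremenko-Lyubich class $\mathcal{B}$ is the set of all transcendental entire functions $f$ for which $\operatorname{sing}(f^{-1})$ is bounded. The Julia set $J(f)\subset\mathbb{C}$ is the set of points at which the family of iterates $(f^n)$ is not equicontinuous with respect to the spherical metric (that is, points having no neighbourhood on which the family is equicontinuous). The notation $\dim$ denotes Hausdorff dimension (of subsets of $\mathbb{C}$). For $R>0$ let $J_R(f)=\{z\in J(f): |f^n(z)|\geq R \text{ for all } n\geq 1\}$. The eventual dimension of a transcendental entire function $f$ is $\operatorname{edim}(f)=\inf_{R>0}\dim J_R(f)$. Two transcendental entire functions $f$ and $g$ are affinely equivalent if there are nonconstant affine functions $\phi,\psi:\mathbb{C}\to\mathbb{C}$ (i.e. maps $z\mapsto az+b$ with $a,b\in\mathbb{C}$, $a\neq0$) such that $\psi\circ f=g\circ\phi$. *)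

theory Defs
  imports "HOL-Complex_Analysis.Complex_Analysis" "HOL-Computational_Algebra.Polynomial"
begin

definition transcendental_entire :: "(complex \<Rightarrow> complex) \<Rightarrow> bool" where
  "transcendental_entire f \<longleftrightarrow>
     f holomorphic_on UNIV \<and> \<not> (\<exists>p :: complex poly. f = poly p)"

definition critical_values :: "(complex \<Rightarrow> complex) \<Rightarrow> complex set" where
  "critical_values f = f ` {z. deriv f z = 0}"

definition asymptotic_values :: "(complex \<Rightarrow> complex) \<Rightarrow> complex set" where
  "asymptotic_values f =
     {a. \<exists>\<gamma> :: real \<Rightarrow> complex. continuous_on {0..} \<gamma> \<and>
           filterlim \<gamma> at_infinity at_top \<and> ((\<lambda>t. f (\<gamma> t)) \<longlongrightarrow> a) at_top}"

definition sing_inv :: "(complex \<Rightarrow> complex) \<Rightarrow> complex set" where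
  "sing_inv f = critical_values f \<union> asymptotic_values f"

definition class_B :: "(complex \<Rightarrow> complex) set" where
  "class_B = {f. transcendental_entire f \<and> bounded (sing_inv f)}"

text \<open>
  The geodesic distance on the unit sphere between the stereographic projections of
  two points of the plane (line element \<open>2 |dz| / (1 + |z|^2)\<close>). The chordal distance
  is \<open>2 c\<close>, where \<open>c\<close> is the argument of \<^const>\<open>arcsin\<close> below.
\<close>

definition spherical_dist :: "complex \<Rightarrow> complex \<Rightarrow> real" where
  "spherical_dist z w =
     2 * arcsin (cmod (z - w) / (sqrt (1 + (cmod z)\<^sup>2) * sqrt (1 + (cmod w)\<^sup>2)))"

text \<open>
  Equicontinuity at every point of \<open>U\<close>. On \<open>U\<close> itself the Euclidean metric may be used,
  since it induces the same topology on the plane as the spherical metric.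
\<close>

definition spherically_equicontinuous_on ::
  "complex set \<Rightarrow> (complex \<Rightarrow> complex) set \<Rightarrow> bool" where
  "spherically_equicontinuous_on U F \<longleftrightarrow>
     (\<forall>z\<in>U. \<forall>\<epsilon>>0. \<exists>\<delta>>0. \<forall>w\<in>U. dist w z < \<delta> \<longrightarrow>
        (\<forall>h\<in>F. spherical_dist (h w) (h z) < \<epsilon>))"

definition julia_set :: "(complex \<Rightarrow> complex) \<Rightarrow> complex set" where
  "julia_set f =
     {z. \<not> (\<exists>U. open U \<and> z \<in> U \<and> spherically_equicontinuous_on U (range (\<lambda>n. f ^^ n)))}"

text \<open>
  Boundedness of the covering sets has to be required explicitly, because \<^const>\<open>diameter\<close>
  takes an unspecified real value on unbounded sets. The sets \<open>U i\<close> may be empty, so finite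
  covers are included. Since \<open>0 powr 0 = 0\<close>, the definitions are meant for exponents \<open>s > 0\<close>
  only; this suffices for the dimension.
\<close>

definition hausdorff_content :: "real \<Rightarrow> real \<Rightarrow> 'a :: metric_space set \<Rightarrow> ennreal" where
  "hausdorff_content s \<delta> A =
     (INF U \<in> {U :: nat \<Rightarrow> 'a set. A \<subseteq> (\<Union>i. U i) \<and>
                 (\<forall>i. bounded (U i) \<and> diameter (U i) \<le> \<delta>)}.
        \<Sum>i. ennreal (diameter (U i) powr s))"

definition hausdorff_measure :: "real \<Rightarrow> 'a :: metric_space set \<Rightarrow> ennreal" where
  "hausdorff_measure s A = (SUP \<delta> \<in> {0<..}. hausdorff_content s \<delta> A)"

definition hausdorff_dim :: "'a :: metric_space set \<Rightarrow> ennreal" where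
  "hausdorff_dim A = (INF s \<in> {s. s > 0 \<and> hausdorff_measure s A = 0}. ennreal s)"

definition julia_outside :: "real \<Rightarrow> (complex \<Rightarrow> complex) \<Rightarrow> complex set" where
  "julia_outside R f = {z \<in> julia_set f. \<forall>n\<ge>1. cmod ((f ^^ n) z) \<ge> R}"

definition edim :: "(complex \<Rightarrow> complex) \<Rightarrow> ennreal" where
  "edim f = (INF R \<in> {0<..}. hausdorff_dim (julia_outside R f))"

definition nonconstant_affine :: "(complex \<Rightarrow> complex) \<Rightarrow> bool" where
  "nonconstant_affine \<phi> \<longleftrightarrow> (\<exists>a b. a \<noteq> 0 \<and> \<phi> = (\<lambda>z. a * z + b))"

definition affinely_equivalent :: "(complex \<Rightarrow> complex) \<Rightarrow> (complex \<Rightarrow> complex) \<Rightarrow> bool" where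
  "affinely_equivalent f g \<longleftrightarrow>
     (\<exists>\<phi> \<psi>. nonconstant_affine \<phi> \<and> nonconstant_affine \<psi> \<and> \<psi> \<circ> f = g \<circ> \<phi>)"

end

theory Submission
  imports Defs
begin

text \<open>
  Why the eventual dimension only depends on the affine equivalence class. Conjugating by an
  affine map changes neither dimensions nor, up to the choice of the radius, the sets of points
  with large orbits, so it suffices to compare \<open>f\<close> with \<open>g = a f + b\<close>; and by symmetry one
  inequality is enough.

  In logarithmic coordinates \<open>z = exp \<zeta>\<close> a function of the Eremenko-Lyubich class is uniformly
  expanding far to the right. If all singular values and \<open>f 0\<close> lie in the disc of radius \<open>R0\<close>, then
  every solution of \<open>f (exp \<zeta>) = exp W\<close> with \<open>Re W > ln R0\<close> extends to an inverse branch \<open>K\<close>,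
  holomorphic on the half-plane \<open>H\<close> to the right of \<open>ln R0\<close>, with \<open>f (exp (K V)) = exp V\<close>
  (\<open>inverse_branch_exists\<close>). Branches are univalent because \<open>f\<close> is not a polynomial
  (\<open>exp_inverse_branch_not_periodic\<close>), and their derivative at \<open>V\<close> is at most \<open>48 / (Re V - ln R0)\<close>
  (\<open>deriv_inverse_branch_bound\<close>). Univalence also gives bounded distortion, so that on discs of a
  fixed radius far to the right a branch is nearly affine (\<open>inverse_branch_estimates\<close>).

  The map \<open>W \<mapsto> ln ((exp W - b) / a)\<close>, called \<open>\<tau>\<close>, is a bounded perturbation of the identity,
  and the inverse branches of \<open>g\<close> are the maps \<open>K \<circ> \<tau>\<close>. Pulling back along the same branches \<open>K\<close>
  without \<open>\<tau>\<close> therefore turns a large orbit \<open>\<zeta>\<close> of \<open>g\<close> into an orbit \<open>\<eta>\<close> of \<open>f\<close> that stays close to it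
  (\<open>shadow_exists\<close>). Two nearby orbits are followed under common branches until they separate. In
  each step the distances of the \<open>\<eta>\<close> and of the \<open>\<zeta>\<close> are multiplied by the same derivative up to a
  bounded factor, whereas both shrink by a factor \<open>\<kappa>\<close> which is as small as desired when the orbits
  are large. Since \<open>6 * \<kappa> powr s \<le> 1\<close> for small \<open>\<kappa>\<close>, the accumulated distortion costs only a power
  \<open>s\<close>: the inverse of \<open>\<zeta> \<mapsto> \<eta>\<close> is Hoelder continuous with exponent \<open>1 - s\<close>
  (\<open>shadow_inverse_holder\<close>). Hence the set of large orbits of \<open>g\<close> has dimension at most \<open>1 / (1 - s)\<close>
  times that of the set of large orbits of \<open>f\<close>, for every \<open>s > 0\<close>.

  The shadowing orbits do lie in the Julia set: small neighbourhoods are blown up by the expansion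
  until they contain a circle around the origin, where \<open>\<bar>f\<bar>\<close> cannot be larger than \<open>R0\<close>
  throughout, while the orbit itself stays large (\<open>exp_log_orbit_in_julia_set\<close>).
\<close>

section \<open>Hausdorff dimension and Hoelder maps\<close>

text \<open>
  A cover whose total weight is below \<open>\<delta> powr s\<close> automatically consists of sets of diameter at most
  \<open>\<delta>\<close>, so for null sets the bound on the diameters can be dropped.
\<close>

lemma hausdorff_measure_eq_0_iff:
  fixes A :: "'a::metric_space set"
  assumes s: "s > 0"
  shows "hausdorff_measure s A = 0 \<longleftrightarrow>
    (\<forall>e>0. \<exists>U. A \<subseteq> (\<Union>i. U i) \<and> (\<forall>i. bounded (U i)) \<and> (\<Sum>i::nat. ennreal (diameter (U i) powr s)) < ennreal e)"
    (is "_ \<longleftrightarrow> (\<forall>e>0. ?cover e)")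
proof
  assume "hausdorff_measure s A = 0"
  then have "hausdorff_content s 1 A = 0"
    unfolding hausdorff_measure_def bot_ennreal[symmetric] SUP_bot_conv by auto
  then show "\<forall>e>0. ?cover e"
    unfolding hausdorff_content_def
    by (smt (verit, ccfv_threshold) INF_less_iff ennreal_less_zero_iff mem_Collect_eq zero_less_iff_neq_zero)
next
  assume R: "\<forall>e>0. ?cover e"
  have "hausdorff_content s \<delta> A = 0" if \<delta>: "\<delta> > 0" for \<delta>
  proof -
    have "hausdorff_content s \<delta> A \<le> 0 + ennreal e" if e: "e > 0" for e
    proof -
      define e' where "e' = min e (\<delta> powr s)"
      have e': "e' > 0" using e \<delta> by (simp add: e'_def)
      from R[rule_format, OF this] obtain U where
        "A \<subseteq> (\<Union>i. U i) \<and> (\<forall>i. bounded (U i)) \<and> (\<Sum>i::nat. ennreal (diameter (U i) powr s)) < ennreal e'" ..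
      then have U: "A \<subseteq> (\<Union>i. U i)" "\<And>i. bounded (U i)" "(\<Sum>i::nat. ennreal (diameter (U i) powr s)) < ennreal e'"
        by blast+
      have "diameter (U i) \<le> \<delta>" for i
      proof -
        have "(\<Sum>j\<in>{i}. ennreal (diameter (U j) powr s)) \<le> (\<Sum>j. ennreal (diameter (U j) powr s))"
          by (rule sum_le_suminf) (rule summableI, rule finite.intros(2)[OF finite.emptyI], rule zero_le)
        then have "ennreal (diameter (U i) powr s) < ennreal e'"
          using le_less_trans[OF _ U(3)] by (simp only: sum.insert finite.emptyI sum.empty add_0_right empty_iff not_False_eq_True)
        then have "diameter (U i) powr s < \<delta> powr s" by (simp add: ennreal_less_iff e'_def)
        then show ?thesis using \<delta> s by (meson linorder_not_le powr_mono2 less_imp_le)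
      qed
      then have "hausdorff_content s \<delta> A \<le> (\<Sum>i::nat. ennreal (diameter (U i) powr s))"
        unfolding hausdorff_content_def using U by (intro INF_lower) auto
      also have "\<dots> \<le> ennreal e'" by (rule less_imp_le[OF U(3)])
      also have "\<dots> \<le> ennreal e" by (rule ennreal_leI) (simp add: e'_def)
      finally show ?thesis by simp
    qed
    then have "hausdorff_content s \<delta> A \<le> 0" by (rule ennreal_le_epsilon)
    then show ?thesis by (simp only: le_zero_eq)
  qed
  then show "hausdorff_measure s A = 0" unfolding hausdorff_measure_def 
    by (simp add: bot_ennreal[symmetric] SUP_bot_conv)
qed

lemma hausdorff_null_UN:
  fixes A :: "nat \<Rightarrow> 'a::metric_space set"
  assumes s: "s > 0" and null: "\<And>i. hausdorff_measure s (A i) = 0"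
  shows "hausdorff_measure s (\<Union>i. A i) = 0"
  unfolding hausdorff_measure_eq_0_iff[OF s]
proof (intro allI impI)
  fix e :: real assume e: "e > 0"
  have "\<exists>U. A n \<subseteq> (\<Union>i. U i) \<and> (\<forall>i. bounded (U i)) \<and>
      (\<Sum>i::nat. ennreal (diameter (U i) powr s)) < ennreal (e/2 * (1/2) ^ Suc n)" for n
    by (rule null[of n, unfolded hausdorff_measure_eq_0_iff[OF s], rule_format]) (use e in simp)
  then obtain U where U: "\<And>n. A n \<subseteq> (\<Union>i. U n i)" "\<And>n i. bounded (U n i)"
      "\<And>n. (\<Sum>i::nat. ennreal (diameter (U n i) powr s)) < ennreal (e/2 * (1/2) ^ Suc n)" by metis
  define V where "V = case_prod U \<circ> prod_decode"
  have "(\<Sum>i. ennreal (diameter (V i) powr s)) = (\<Sum>i. (\<lambda>(n,i). ennreal (diameter (U n i) powr s)) (prod_decode i))"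
    by (simp only: V_def case_prod_unfold o_def)
  also have "\<dots> = (\<Sum>n. \<Sum>i. ennreal (diameter (U n i) powr s))"
    by (rule suminf_ennreal_2dimen) (simp only: prod.case)
  also have "\<dots> \<le> (\<Sum>n. ennreal (e/2 * (1/2) ^ Suc n))"
    using U(3) by (intro suminf_le) (auto intro: less_imp_le)
  also have "\<dots> = ennreal (e/2)"
    using sums_mult[OF power_half_series, of "e/2"] e by (intro suminf_ennreal_eq) auto
  also have "\<dots> < ennreal e" using e by (simp add: ennreal_less_iff)
  finally have sm: "(\<Sum>i. ennreal (diameter (V i) powr s)) < ennreal e" .
  have "(\<Union>n. A n) \<subseteq> (\<Union>i. V i)"
  proof
    fix x assume "x \<in> (\<Union>n. A n)"
    then obtain n i where "x \<in> U n i" using U(1) by blast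
    then have "x \<in> V (prod_encode (n, i))" by (simp add: V_def)
    then show "x \<in> (\<Union>i. V i)" by blast
  qed
  then show "\<exists>U. (\<Union>n. A n) \<subseteq> (\<Union>i. U i) \<and> (\<forall>i. bounded (U i)) \<and> (\<Sum>i::nat. ennreal (diameter (U i) powr s)) < ennreal e"
    using sm U(2) by (intro exI[of _ V]) (auto simp: V_def case_prod_unfold)
qed

text \<open>
  The estimate says that \<open>\<theta>\<close> is injective with a Hoelder continuous inverse. Pulling a cover of \<open>Y\<close> back
  by \<open>\<theta>\<close> is the same as mapping it forward by that inverse.
\<close>

lemma hausdorff_null_inverse_holder:
  fixes X :: "'a::metric_space set" and Y :: "'b::metric_space set"
  assumes "u > 0" "\<alpha> > 0" "C > 0" and \<theta>: "\<theta> ` X \<subseteq> Y"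
    and holder: "\<And>x x'. x \<in> X \<Longrightarrow> x' \<in> X \<Longrightarrow> dist x x' \<le> C * dist (\<theta> x) (\<theta> x') powr \<alpha>"
    and null: "hausdorff_measure u Y = 0"
  shows "hausdorff_measure (u / \<alpha>) X = 0"
proof -
  have u\<alpha>: "u / \<alpha> > 0" using assms by simp
  show ?thesis unfolding hausdorff_measure_eq_0_iff[OF u\<alpha>]
  proof (intro allI impI)
    fix e :: real assume e: "e > 0"
    define D where "D = C powr (u/\<alpha>)"
    have D: "D > 0" using assms by (simp add: D_def)
    from null[unfolded hausdorff_measure_eq_0_iff[OF assms(1)], rule_format, OF divide_pos_pos[OF e this]]
    obtain U where "Y \<subseteq> (\<Union>i. U i) \<and> (\<forall>i. bounded (U i)) \<and> (\<Sum>i::nat. ennreal (diameter (U i) powr u)) < ennreal (e/D)" ..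
    then have U: "Y \<subseteq> (\<Union>i. U i)" "\<And>i. bounded (U i)" "(\<Sum>i::nat. ennreal (diameter (U i) powr u)) < ennreal (e/D)"
      by blast+
    define V where "V i = {x \<in> X. \<theta> x \<in> U i}" for i
    have d: "dist x x' \<le> C * diameter (U i) powr \<alpha>" if "x \<in> V i" "x' \<in> V i" for i x x'
    proof -
      have "dist (\<theta> x) (\<theta> x') powr \<alpha> \<le> diameter (U i) powr \<alpha>"
        using diameter_bounded_bound[OF U(2)] that assms by (intro powr_mono2) (auto simp: V_def)
      then show ?thesis using holder[of x x'] that assms(3) by (smt (verit, best) V_def mem_Collect_eq mult_left_mono)
    qed
    have bV: "bounded (V i)" for i
      using d unfolding bounded_two_points by blast
    have dV: "diameter (V i) \<le> C * diameter (U i) powr \<alpha>" for i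
      using d[of _ i] assms(3) unfolding diameter_def[of "V i"] by (auto intro!: cSUP_least)
    have "(\<Sum>i. ennreal (diameter (V i) powr (u/\<alpha>))) \<le> (\<Sum>i. ennreal D * ennreal (diameter (U i) powr u))"
    proof (intro suminf_le)
      fix i
      have "diameter (V i) powr (u/\<alpha>) \<le> (C * diameter (U i) powr \<alpha>) powr (u/\<alpha>)"
        using dV diameter_ge_0[OF bV] u\<alpha> by (intro powr_mono2) auto
      also have "\<dots> = D * diameter (U i) powr u"
        using assms by (simp add: D_def powr_mult powr_powr)
      finally show "ennreal (diameter (V i) powr (u/\<alpha>)) \<le> ennreal D * ennreal (diameter (U i) powr u)"
        using D by (simp add: ennreal_mult[symmetric] ennreal_leI)
    qed auto
    also have "\<dots> = ennreal D * (\<Sum>i. ennreal (diameter (U i) powr u))" by simp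
    also have "\<dots> < ennreal D * ennreal (e/D)"
      using U(3) D by (intro ennreal_mult_strict_left_mono) auto
    also have "\<dots> = ennreal e" using D e by (simp add: ennreal_mult[symmetric])
    finally have "(\<Sum>i. ennreal (diameter (V i) powr (u/\<alpha>))) < ennreal e" .
    moreover have "X \<subseteq> (\<Union>i. V i)" using \<theta> U(1) by (auto simp: V_def)
    ultimately show "\<exists>U. X \<subseteq> (\<Union>i. U i) \<and> (\<forall>i. bounded (U i)) \<and> (\<Sum>i::nat. ennreal (diameter (U i) powr (u/\<alpha>))) < ennreal e"
      using bV by blast
  qed
qed

text \<open>
  By Lindelof's theorem, countably many of the neighbourhoods cover \<open>X\<close>, and null sets are closed
  under countable unions.
\<close>

lemma hausdorff_dim_le_locally_inverse_holder:
  fixes X :: "'a::{metric_space, second_countable_topology} set" and Y :: "'b::metric_space set"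
  assumes \<alpha>: "\<alpha> > 0" and \<theta>: "\<theta> ` X \<subseteq> Y"
    and holder: "\<And>x. x \<in> X \<Longrightarrow> \<exists>U C. open U \<and> x \<in> U \<and> C > 0 \<and>
       (\<forall>y\<in>X \<inter> U. \<forall>z\<in>X \<inter> U. dist y z \<le> C * dist (\<theta> y) (\<theta> z) powr \<alpha>)"
  shows "ennreal \<alpha> * hausdorff_dim X \<le> hausdorff_dim Y"
proof -
  obtain U C where UC: "\<And>x. x \<in> X \<Longrightarrow> open (U x) \<and> x \<in> U x \<and> C x > (0::real) \<and>
       (\<forall>y\<in>X \<inter> U x. \<forall>z\<in>X \<inter> U x. dist y z \<le> C x * dist (\<theta> y) (\<theta> z) powr \<alpha>)"
    using holder by metis
  obtain \<F> where \<F>: "\<F> \<subseteq> U ` X" "countable \<F>" "\<Union>\<F> = \<Union>(U ` X)"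
    using Lindelof[of "U ` X"] UC by auto
  have "ennreal \<alpha> * hausdorff_dim X \<le> ennreal u" if u: "u > 0" "hausdorff_measure u Y = 0" for u
  proof -
    define A where "A i = X \<inter> from_nat_into (insert {} \<F>) i" for i
    have ne: "insert {} \<F> \<noteq> {}" by simp
    have "hausdorff_measure (u/\<alpha>) (A i) = 0" for i
    proof -
      have "from_nat_into (insert {} \<F>) i \<in> insert {} \<F>" by (rule from_nat_into) simp
      then consider "A i = {}" | x where "x \<in> X" "A i = X \<inter> U x" using \<F>(1) by (auto simp: A_def)
      then show ?thesis
      proof cases
        case 1
        show ?thesis
          by (rule hausdorff_null_inverse_holder[OF u(1) \<alpha>, of 1 \<theta> _ Y]) (use 1 u in auto)
      next
        case 2
        show ?thesis
          by (rule hausdorff_null_inverse_holder[OF u(1) \<alpha>, of "C x" \<theta> _ Y]) (use 2 u UC[of x] \<theta> in auto)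
      qed
    qed
    then have "hausdorff_measure (u/\<alpha>) (\<Union>i. A i) = 0" using u \<alpha> by (intro hausdorff_null_UN) auto
    moreover have "(\<Union>i. A i) = X"
    proof -
      have "range (from_nat_into (insert {} \<F>)) = insert {} \<F>"
        by (rule range_from_nat_into) (use \<F> in auto)
      then have "(\<Union>i. A i) = X \<inter> \<Union>(insert {} \<F>)" unfolding A_def by (metis Int_UN_distrib)
      then show ?thesis using \<F>(3) UC by auto
    qed
    ultimately have "hausdorff_dim X \<le> ennreal (u/\<alpha>)"
      unfolding hausdorff_dim_def using u \<alpha> by (intro INF_lower) auto
    then have "ennreal \<alpha> * hausdorff_dim X \<le> ennreal \<alpha> * ennreal (u/\<alpha>)" by (rule mult_left_mono) simp
    also have "\<dots> = ennreal u" using u \<alpha> by (simp add: ennreal_mult[symmetric])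
    finally show ?thesis .
  qed
  then show ?thesis unfolding hausdorff_dim_def[of Y] by (intro INF_greatest) auto
qed

section \<open>Distortion of univalent functions\<close>

lemma holomorphic_log_convex:
  assumes "open S" "convex S" "h holomorphic_on S" "\<And>z. z \<in> S \<Longrightarrow> h z \<noteq> 0"
  obtains l where "l holomorphic_on S" "\<And>z. z \<in> S \<Longrightarrow> exp (l z) = h z"
  using simply_connected_eq_holomorphic_log[OF assms(1)] convex_imp_simply_connected[OF assms(2)] assms(3,4)
  by metis

text \<open>
  A weak form of Koebe's growth theorem, with a constant that is far from optimal. The function
  cannot cover the disc of radius 2, for otherwise its inverse would contradict Cauchy's inequality.
  If it omits \<open>\<omega>\<close>, then \<open>1 - \<phi> / \<omega>\<close> has a square root, and the branch \<open>\<xi>\<close> with \<open>\<xi> 0 = -1\<close> omits both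
  \<open>0\<close> and \<open>1\<close>, because \<open>\<xi> z = 1\<close> would mean \<open>\<phi> z = 0\<close>. Schottky's theorem bounds \<open>\<xi>\<close>.
\<close>

lemma univalent_bounded:
  obtains C where "C > 0" "\<And>\<phi> z. \<phi> holomorphic_on ball 0 1 \<Longrightarrow> inj_on \<phi> (ball 0 1) \<Longrightarrow> \<phi> 0 = 0 \<Longrightarrow>
     deriv \<phi> 0 = 1 \<Longrightarrow> cmod z \<le> 1/2 \<Longrightarrow> cmod (\<phi> z) \<le> C"
proof -
  define D where "D = exp (pi * exp (pi * (2 + 2 * 1 + 12 * (2/3) / (1 - 2/3))))"
  have "cmod (\<phi> z) \<le> 2 * (1 + D\<^sup>2)"
    if hol: "\<phi> holomorphic_on ball 0 1" and inj: "inj_on \<phi> (ball 0 1)" and \<phi>0: "\<phi> 0 = 0"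
      and d1: "deriv \<phi> 0 = 1" and z: "cmod z \<le> 1/2" for \<phi> z
  proof -
    \<comment> \<open>If the image contained this disc, the inverse would map it into the unit disc with derivative 1
      at the centre, but the derivative is at most 1/2.\<close>
    have "\<exists>\<omega>. \<omega> \<in> cball 0 2 \<and> \<omega> \<notin> \<phi> ` ball 0 1"
    proof (rule ccontr)
      assume "\<not> ?thesis"
      then have sub: "cball 0 2 \<subseteq> \<phi> ` ball 0 1" by blast
      obtain g where g: "g holomorphic_on \<phi> ` ball 0 1"
        "\<And>z. z \<in> ball 0 1 \<Longrightarrow> deriv \<phi> z * deriv g (\<phi> z) = 1" "\<And>z. z \<in> ball 0 1 \<Longrightarrow> g (\<phi> z) = z"
        using holomorphic_has_inverse[OF hol open_ball inj] by metis
      have gh: "g holomorphic_on cball 0 2" by (rule holomorphic_on_subset[OF g(1) sub])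
      have "cmod (g x) \<le> 1" if x: "cmod (0 - x) = 2" for x
      proof -
        have "x \<in> cball 0 2" using x by simp
        then obtain y where "y \<in> ball 0 1" "x = \<phi> y" using sub by blast
        then show ?thesis using g(3)[of y] by simp
      qed
      from Cauchy_inequality[OF holomorphic_on_subset[OF gh] holomorphic_on_imp_continuous_on[OF gh] _ this, of 1]
      have "cmod (deriv g 0) \<le> 1/2" by auto
      moreover have "deriv g 0 = 1" using g(2)[of 0] \<phi>0 d1 by simp
      ultimately show False by simp
    qed
    then obtain \<omega> where \<omega>: "cmod \<omega> \<le> 2" "\<omega> \<notin> \<phi> ` ball 0 1" by auto
    then have \<omega>0: "\<omega> \<noteq> 0" using \<phi>0 by (metis centre_in_ball image_eqI zero_less_one)
    have "1 - \<phi> x / \<omega> \<noteq> 0" if "x \<in> ball 0 1" for x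
      using \<omega>(2) \<omega>0 that by (auto simp: field_simps)
    moreover have "(\<lambda>x. 1 - \<phi> x / \<omega>) holomorphic_on ball 0 1"
      by (intro holomorphic_intros hol) (use \<omega>0 in auto)
    ultimately obtain l where l: "l holomorphic_on ball 0 1" "\<And>x. x \<in> ball 0 1 \<Longrightarrow> exp (l x) = 1 - \<phi> x / \<omega>"
      using holomorphic_log_convex[of "ball 0 1" "\<lambda>x. 1 - \<phi> x / \<omega>"] by auto
    define \<xi> where "\<xi> x = - exp ((l x - l 0) / 2)" for x
    have \<xi>2: "(\<xi> x)\<^sup>2 = 1 - \<phi> x / \<omega>" if "x \<in> ball 0 1" for x
    proof -
      have "(\<xi> x)\<^sup>2 = exp (l x - l 0)" by (simp add: \<xi>_def power2_eq_square exp_add[symmetric])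
      also have "\<dots> = (1 - \<phi> x / \<omega>) / (1 - \<phi> 0 / \<omega>)"
        using l(2)[OF that] l(2)[of 0] by (simp add: exp_diff)
      finally show ?thesis using \<phi>0 by simp
    qed
    have \<xi>1: "\<xi> x \<noteq> 1" if x: "x \<in> ball 0 1" for x
    proof
      assume "\<xi> x = 1"
      then have "\<phi> x = \<phi> 0" using \<xi>2[OF x] \<omega>0 \<phi>0 by simp
      then have "x = 0" using inj x by (auto dest: inj_onD)
      with \<open>\<xi> x = 1\<close> have "(-1::complex) = 1" by (simp add: \<xi>_def)
      then show False by simp
    qed
    \<comment> \<open>Schottky's theorem needs the closed unit disc, hence the rescaling by 3/4.\<close>
    have "cmod ((\<lambda>x. \<xi> (3/4 * x)) (4/3 * z)) \<le> D"
      unfolding D_def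
    proof (rule Schottky[of "\<lambda>x. \<xi> (3/4 * x)" 1 "2/3" "4/3 * z"])
      have "\<xi> holomorphic_on ball 0 1" unfolding \<xi>_def by (intro holomorphic_intros l) auto
      then show "(\<lambda>x. \<xi> (3/4 * x)) holomorphic_on cball 0 1"
        by (intro holomorphic_on_compose_gen[of "\<lambda>x. 3/4 * x" _ \<xi> "ball 0 1", unfolded o_def])
           (auto intro!: holomorphic_intros simp: norm_mult)
      show "\<not> (\<xi> (3/4 * x) = 0 \<or> \<xi> (3/4 * x) = 1)" if "x \<in> cball 0 1" for x
        using \<xi>1[of "3/4 * x"] that by (auto simp: \<xi>_def norm_mult)
    qed (use z in \<open>auto simp: \<xi>_def norm_mult\<close>)
    then have D: "cmod (\<xi> z) \<le> D" by simp
    have "\<phi> z = \<omega> * (1 - (\<xi> z)\<^sup>2)" using \<xi>2[of z] z \<omega>0 by (simp add: field_simps)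
    then have "cmod (\<phi> z) = cmod \<omega> * cmod (1 - (\<xi> z)\<^sup>2)" by (simp add: norm_mult)
    also have "\<dots> \<le> 2 * (1 + D\<^sup>2)"
    proof (rule mult_mono)
      have "cmod (1 - (\<xi> z)\<^sup>2) \<le> 1 + (cmod (\<xi> z))\<^sup>2" by (metis norm_one norm_power norm_triangle_ineq4)
      also have "\<dots> \<le> 1 + D\<^sup>2" using D by (simp add: power_mono)
      finally show "cmod (1 - (\<xi> z)\<^sup>2) \<le> 1 + D\<^sup>2" .
    qed (use \<omega> in auto)
    finally show ?thesis .
  qed
  moreover have "2 * (1 + D\<^sup>2) > 0" by (simp add: add_pos_nonneg)
  ultimately show ?thesis using that by blast
qed

text \<open>
  After normalisation the bound on \<open>\<phi>\<close> and Cauchy's inequality bound \<open>\<phi>''\<close>, so \<open>\<phi>'\<close> is Lipschitz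
  near the origin.
\<close>

lemma univalent_distortion:
  obtains C where "C > 0" "\<And>K p r v. r > 0 \<Longrightarrow> K holomorphic_on ball p r \<Longrightarrow> inj_on K (ball p r) \<Longrightarrow>
     cmod (v - p) \<le> r / 4 \<Longrightarrow> cmod (deriv K v - deriv K p) \<le> C * (cmod (v - p) / r) * cmod (deriv K p)"
proof -
  obtain C where C: "C > 0" "\<And>\<phi> z. \<phi> holomorphic_on ball 0 1 \<Longrightarrow> inj_on \<phi> (ball 0 1) \<Longrightarrow> \<phi> 0 = 0 \<Longrightarrow>
     deriv \<phi> 0 = 1 \<Longrightarrow> cmod z \<le> 1/2 \<Longrightarrow> cmod (\<phi> z) \<le> C"
    by (rule univalent_bounded) (rule that; assumption)
  have "cmod (deriv K v - deriv K p) \<le> 32 * C * (cmod (v - p) / r) * cmod (deriv K p)"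
    if r: "r > 0" and hol: "K holomorphic_on ball p r" and inj: "inj_on K (ball p r)" and v: "cmod (v - p) \<le> r / 4"
    for K p r v
  proof -
    define c where "c = deriv K p"
    have c: "c \<noteq> 0" unfolding c_def
      by (rule holomorphic_injective_imp_regular[OF hol open_ball inj]) (use r in simp)
    define \<phi> where "\<phi> z = (K (p + r * z) - K p) / (r * c)" for z :: complex
    have in_ball: "p + r * z \<in> ball p r" if "z \<in> ball 0 1" for z :: complex
      using that r by (simp add: dist_norm norm_mult)
    have \<phi>d: "(\<phi> has_field_derivative deriv K (p + r * z) / c) (at z)" if "z \<in> ball 0 1" for z :: complex
    proof -
      have "(K has_field_derivative deriv K (p + r * z)) (at (p + r * z))"
        by (rule holomorphic_derivI[OF hol open_ball in_ball[OF that]])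
      then have "((\<lambda>z. K (p + r * z)) has_field_derivative deriv K (p + r * z) * r) (at z)"
        by (rule DERIV_chain2) (auto intro!: derivative_eq_intros)
      then show ?thesis unfolding \<phi>_def using r c by (auto intro!: derivative_eq_intros)
    qed
    have \<phi>h: "\<phi> holomorphic_on ball 0 1"
      unfolding holomorphic_on_open[OF open_ball] using \<phi>d by blast
    have \<phi>inj: "inj_on \<phi> (ball 0 1)"
    proof (rule inj_onI)
      fix x y assume xy: "x \<in> ball 0 1" "y \<in> ball 0 1" "\<phi> x = \<phi> y"
      then have "K (p + r * x) = K (p + r * y)" using r c by (simp add: \<phi>_def)
      then have "p + r * x = p + r * y" using inj in_ball xy by (auto dest: inj_onD)
      then show "x = y" using r by simp
    qed
    have \<phi>0: "\<phi> 0 = 0" by (simp add: \<phi>_def)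
    have \<phi>d1: "deriv \<phi> z = deriv K (p + r * z) / c" if "z \<in> ball 0 1" for z :: complex
      using \<phi>d[OF that] by (rule DERIV_imp_deriv)
    then have \<phi>d0: "deriv \<phi> 0 = 1" using c by (simp add: c_def)
    have bd: "cmod (\<phi> z) \<le> C" if "cmod z \<le> 1/2" for z
      by (rule C(2)[OF \<phi>h \<phi>inj \<phi>0 \<phi>d0 that])
    have d2: "cmod (deriv (deriv \<phi>) w) \<le> 32 * C" if w: "w \<in> cball 0 (1/4)" for w
    proof -
      have sub: "cball w (1/4) \<subseteq> ball 0 1"
      proof
        fix x assume "x \<in> cball w (1/4)"
        then show "x \<in> ball 0 1" using w norm_triangle_ineq4[of w "w - x"] by (auto simp: dist_norm)
      qed
      have "cmod ((deriv ^^ 2) \<phi> w) \<le> fact 2 * C / (1/4) ^ 2"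
      proof (rule Cauchy_inequality)
        show "\<phi> holomorphic_on ball w (1/4)" using sub ball_subset_cball by (blast intro: holomorphic_on_subset[OF \<phi>h])
        show "continuous_on (cball w (1/4)) \<phi>"
          using holomorphic_on_imp_continuous_on[OF \<phi>h] sub continuous_on_subset by blast
        show "cmod (\<phi> x) \<le> C" if "cmod (w - x) = 1/4" for x
          using bd[of x] w that norm_triangle_ineq4[of w "w - x"] by simp
      qed simp
      then show ?thesis by (simp add: numeral_2_eq_2 power2_eq_square)
    qed
    define z where "z = (v - p) / r"
    have vz: "v = p + r * z" using r by (simp add: z_def)
    have nz: "cmod z = cmod (v - p) / r" using r by (simp add: z_def norm_divide)
    have zb: "z \<in> cball 0 (1/4)" using v r by (simp add: nz field_simps)
    have "cmod (deriv \<phi> z - deriv \<phi> 0) \<le> 32 * C * cmod (z - 0)"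
    proof (rule field_differentiable_bound[OF convex_cball])
      show "(deriv \<phi> has_field_derivative deriv (deriv \<phi>) w) (at w within cball 0 (1/4))" if "w \<in> cball 0 (1/4)" for w
        by (rule has_field_derivative_at_within, rule holomorphic_derivI[OF holomorphic_deriv[OF \<phi>h open_ball] open_ball])
           (use that in auto)
    qed (use d2 zb in auto)
    moreover have "deriv \<phi> z - deriv \<phi> 0 = (deriv K v - c) / c"
      using \<phi>d1[of z] \<phi>d1[of 0] zb c by (simp add: vz c_def diff_divide_distrib)
    ultimately have "cmod (deriv K v - c) \<le> 32 * C * (cmod (v - p) / r) * cmod c"
      using c by (simp add: norm_divide nz divide_le_eq)
    then show ?thesis by (simp add: c_def)
  qed
  then show ?thesis using that[of "32 * C"] C(1) by simp
qed

section \<open>Lifting holomorphic maps through an entire function\<close>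

lemma holomorphic_glue:
  fixes U :: "'i \<Rightarrow> complex set"
  assumes "\<And>i. i \<in> I \<Longrightarrow> open (U i)" and "\<And>i. i \<in> I \<Longrightarrow> h i holomorphic_on U i"
    and agree: "\<And>i j x. i \<in> I \<Longrightarrow> j \<in> I \<Longrightarrow> x \<in> U i \<Longrightarrow> x \<in> U j \<Longrightarrow> h i x = h j x"
  obtains g where "g holomorphic_on (\<Union>i\<in>I. U i)" "\<And>i x. i \<in> I \<Longrightarrow> x \<in> U i \<Longrightarrow> g x = h i x"
proof -
  define g where "g x = h (SOME i. i \<in> I \<and> x \<in> U i) x" for x
  have g: "g x = h i x" if "i \<in> I" "x \<in> U i" for i x
  proof -
    have "(SOME i. i \<in> I \<and> x \<in> U i) \<in> I \<and> x \<in> U (SOME i. i \<in> I \<and> x \<in> U i)"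
      by (rule someI[of _ i]) (use that in auto)
    with that show ?thesis unfolding g_def by (intro agree) auto
  qed
  have "g holomorphic_on (\<Union>i\<in>I. U i)"
  proof (rule holomorphic_on_UN_open)
    fix i assume i: "i \<in> I"
    show "g holomorphic_on U i"
      by (rule holomorphic_transform[OF assms(2)[OF i]]) (use g i in auto)
  qed (use assms in auto)
  with g show ?thesis by (rule that[rotated]) 
qed

text \<open>
  This is how the absence of asymptotic values is used: a curve whose image converges either tends
  to infinity or converges. It has a finite accumulation point \<open>q\<close> with \<open>f q = w\<close>, and since the
  solutions of \<open>f z = w\<close> are isolated, \<open>f\<close> stays away from \<open>w\<close> on small circles around \<open>q\<close>, so that the
  curve cannot cross them any more once its image is close to \<open>w\<close>.
\<close>

lemma tendsto_of_image_tendsto: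
  fixes \<gamma> :: "real \<Rightarrow> complex"
  assumes holo: "f holomorphic_on UNIV" and nc: "\<not> f constant_on UNIV"
    and cont: "continuous_on {0..} \<gamma>"
    and lim: "((\<lambda>t. f (\<gamma> t)) \<longlongrightarrow> w) at_top"
    and bdd: "\<not> filterlim \<gamma> at_infinity at_top"
  obtains q where "(\<gamma> \<longlongrightarrow> q) at_top" "f q = w"
proof -
  have contf: "continuous_on UNIV f" by (rule holomorphic_on_imp_continuous_on[OF holo])
  from bdd obtain B where B: "\<not> eventually (\<lambda>t. B \<le> norm (\<gamma> t)) at_top"
    unfolding filterlim_at_infinity[OF order.refl] by blast
  have "\<exists>t\<ge>real n. norm (\<gamma> t) < B" for n
    using B unfolding eventually_at_top_linorder by (metis not_le)
  then obtain t where t: "\<And>n. t n \<ge> real n" "\<And>n. norm (\<gamma> (t n)) < B" by metis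
  have tinf: "filterlim t at_top sequentially"
    by (rule filterlim_at_top_mono[OF filterlim_real_sequentially]) (use t in auto)
  have "\<forall>n. (\<gamma> \<circ> t) n \<in> cball 0 B" using t(2) by (auto intro: less_imp_le)
  then obtain q r where r: "strict_mono r" and q: "((\<gamma> \<circ> t) \<circ> r) \<longlonglongrightarrow> q"
    using compact_cball[of "0::complex" B] unfolding compact_def by blast
  have trinf: "filterlim (t \<circ> r) at_top sequentially"
    using filterlim_compose[OF tinf filterlim_subseq[OF r]] by (simp add: o_def)
  have "(\<lambda>n. f (((\<gamma> \<circ> t) \<circ> r) n)) \<longlonglongrightarrow> f q"
    by (rule continuous_on_tendsto_compose[OF contf q]) auto
  moreover have "(\<lambda>n. f (((\<gamma> \<circ> t) \<circ> r) n)) \<longlonglongrightarrow> w"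
    using filterlim_compose[OF lim trinf] by (simp add: o_def)
  ultimately have fq: "f q = w" using LIMSEQ_unique by blast
  have "\<not> (\<lambda>z. f z - w) constant_on UNIV" using nc unfolding constant_on_def by (metis add_diff_cancel diff_add_cancel)
  moreover have "(\<lambda>z. f z - w) holomorphic_on UNIV" by (intro holomorphic_intros holo)
  ultimately obtain d where d: "d > 0" "\<And>z. z \<in> ball q d - {q} \<Longrightarrow> f z - w \<noteq> 0"
    using isolated_zeros[of "\<lambda>z. f z - w" UNIV q] fq
    by (metis (no_types, lifting) UNIV_I connected_UNIV constant_on_def open_UNIV right_minus_eq)
  have "eventually (\<lambda>s. \<gamma> s \<in> ball q e) at_top" if "e > 0" for e
  proof -
    define c where "c = min e (d/2)"
    have c: "0 < c" "c \<le> e" "c < d" using d(1) that by (auto simp: c_def)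
    have "sphere q c \<noteq> {}" using c by simp
    moreover have "continuous_on (sphere q c) (\<lambda>z. norm (f z - w))"
      by (intro continuous_intros continuous_on_subset[OF contf]) auto
    ultimately obtain z0 where z0: "z0 \<in> sphere q c" "\<And>z. z \<in> sphere q c \<Longrightarrow> norm (f z0 - w) \<le> norm (f z - w)"
      using continuous_attains_inf[OF compact_sphere] by metis
    have "norm (f z0 - w) > 0" using d(2)[of z0] z0(1) c by (auto simp: dist_norm)
    with lim have "eventually (\<lambda>s. dist (f (\<gamma> s)) w < norm (f z0 - w)) at_top"
      by (rule tendstoD)
    then obtain T where T: "\<And>s. s \<ge> T \<Longrightarrow> norm (f (\<gamma> s) - w) < norm (f z0 - w)"
      unfolding eventually_at_top_linorder dist_norm by auto
    have "eventually (\<lambda>n. dist (((\<gamma> \<circ> t) \<circ> r) n) q < c) sequentially"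
      using tendstoD[OF q c(1)] .
    moreover have "eventually (\<lambda>n. (t \<circ> r) n \<ge> max T 0) sequentially"
      using trinf unfolding filterlim_at_top by blast
    ultimately have "eventually (\<lambda>n. dist (((\<gamma> \<circ> t) \<circ> r) n) q < c \<and> (t \<circ> r) n \<ge> max T 0) sequentially"
      by eventually_elim auto
    then obtain s1 where s1: "dist (\<gamma> s1) q < c" "s1 \<ge> T" "s1 \<ge> 0"
      unfolding eventually_sequentially by auto
    have "dist (\<gamma> s) q < c" if "s \<ge> s1" for s
    proof (rule ccontr)
      assume "\<not> dist (\<gamma> s) q < c"
      then have ge: "c \<le> dist (\<gamma> s) q" by simp
      have "continuous_on {s1..s} (\<lambda>u. dist (\<gamma> u) q)"
        by (intro continuous_intros continuous_on_subset[OF cont]) (use s1 in auto)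
      from IVT'[of "\<lambda>u. dist (\<gamma> u) q", OF less_imp_le[OF s1(1)] ge that this]
      obtain u where u: "s1 \<le> u" "u \<le> s" "dist (\<gamma> u) q = c" by blast
      then have "\<gamma> u \<in> sphere q c" by (simp add: dist_commute)
      from z0(2)[OF this] T[of u] u s1 show False by simp
    qed
    then show ?thesis using c unfolding eventually_at_top_linorder
      by (intro exI[of _ s1]) (auto simp: dist_commute intro: less_le_trans)
  qed
  then have "(\<gamma> \<longlongrightarrow> q) at_top"
    by (auto intro!: tendstoI simp: dist_commute)
  with fq show ?thesis by (rule that[rotated])
qed

text \<open>
  Where \<open>f\<close> is locally injective, the set on which two lifts agree is open and closed.
\<close>

lemma lifts_unique:
  fixes h1 h2 :: "'a::metric_space \<Rightarrow> complex"
  assumes holo: "f holomorphic_on UNIV" and conn: "connected S"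
    and cont: "continuous_on S h1" "continuous_on S h2"
    and eq: "\<And>x. x \<in> S \<Longrightarrow> f (h1 x) = f (h2 x)"
    and crit: "\<And>x. x \<in> S \<Longrightarrow> deriv f (h1 x) \<noteq> 0"
    and x0: "x0 \<in> S" "h1 x0 = h2 x0" and x: "x \<in> S"
  shows "h1 x = h2 x"
proof -
  define T where "T = {x \<in> S. h1 x - h2 x = 0}"
  have "closedin (top_of_set S) T"
    unfolding T_def by (intro continuous_closedin_preimage_constant continuous_intros cont)
  moreover have "openin (top_of_set S) T"
    unfolding openin_euclidean_subtopology_iff
  proof (intro conjI ballI)
    show "T \<subseteq> S" by (auto simp: T_def)
    fix y assume "y \<in> T"
    then have y: "y \<in> S" "h1 y = h2 y" by (auto simp: T_def)
    obtain r where r: "r > 0" "inj_on f (ball (h1 y) r)"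
      using has_complex_derivative_locally_injective[OF holo _ open_UNIV crit[OF y(1)]] by auto
    obtain d1 where d1: "d1 > 0" "\<And>x. x \<in> S \<Longrightarrow> dist x y < d1 \<Longrightarrow> dist (h1 x) (h1 y) < r"
      using cont(1) y(1) r(1) unfolding continuous_on_iff by metis
    obtain d2 where d2: "d2 > 0" "\<And>x. x \<in> S \<Longrightarrow> dist x y < d2 \<Longrightarrow> dist (h2 x) (h2 y) < r"
      using cont(2) y(1) r(1) unfolding continuous_on_iff by metis
    show "\<exists>e>0. \<forall>x'\<in>S. dist x' y < e \<longrightarrow> x' \<in> T"
    proof (intro exI[of _ "min d1 d2"] conjI ballI impI)
      fix x' assume x': "x' \<in> S" "dist x' y < min d1 d2"
      then have "h1 x' \<in> ball (h1 y) r" "h2 x' \<in> ball (h1 y) r"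
        using d1(2)[of x'] d2(2)[of x'] y by (auto simp: dist_commute)
      then have "h1 x' = h2 x'" using r(2) eq[OF x'(1)] by (auto dest: inj_onD)
      then show "x' \<in> T" using x' by (simp add: T_def)
    qed (use d1 d2 in auto)
  qed
  ultimately have "T = {} \<or> T = S" using conn unfolding connected_clopen by blast
  then show ?thesis using x0 x unfolding T_def by auto
qed

text \<open>
  The neighbourhood \<open>V\<close> serves to identify \<open>k\<close> with other lifts that come close to \<open>q\<close>.
\<close>

lemma local_lift:
  assumes holo: "f holomorphic_on UNIV" and E: "E holomorphic_on S" "open S" "p \<in> S"
    and q: "f q = E p" and crit: "deriv f q \<noteq> 0"
  obtains e k V where "e > 0" "ball p e \<subseteq> S" "k holomorphic_on ball p e" "open V" "q \<in> V"
    "\<And>x. x \<in> ball p e \<Longrightarrow> f (k x) = E x"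
    "\<And>x v. x \<in> ball p e \<Longrightarrow> v \<in> V \<Longrightarrow> f v = E x \<Longrightarrow> v = k x"
proof -
  obtain r where r: "r > 0" "inj_on f (ball q r)"
    using has_complex_derivative_locally_injective[OF holo _ open_UNIV crit] by auto
  have hb: "f holomorphic_on ball q r" by (rule holomorphic_on_subset[OF holo]) auto
  obtain g where g: "g holomorphic_on (f ` ball q r)" "\<And>z. z \<in> ball q r \<Longrightarrow> g (f z) = z"
    using holomorphic_has_inverse[OF hb open_ball r(2)] by metis
  have "open (f ` ball q r)" using open_mapping_thm3[OF hb open_ball r(2)] .
  then have "open (S \<inter> E -` (f ` ball q r))"
    using continuous_open_preimage[OF holomorphic_on_imp_continuous_on[OF E(1)] E(2)] by blast
  moreover have "p \<in> S \<inter> E -` (f ` ball q r)" using E(3) q r(1) by (auto intro!: image_eqI[of _ _ q])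
  ultimately obtain e where e: "e > 0" "ball p e \<subseteq> S \<inter> E -` (f ` ball q r)"
    unfolding open_contains_ball by blast
  show ?thesis
  proof (rule that[of e "\<lambda>x. g (E x)" "ball q r"])
    show "(\<lambda>x. g (E x)) holomorphic_on ball p e"
      using holomorphic_on_compose_gen[OF holomorphic_on_subset[OF E(1), of "ball p e"] g(1)] e(2)
      by (auto simp: o_def)
    show "f (g (E x)) = E x" if x: "x \<in> ball p e" for x
    proof -
      obtain v where "v \<in> ball q r" "E x = f v" using subsetD[OF e(2) x] by auto
      then show ?thesis using g(2) by auto
    qed
    show "v = g (E x)" if "x \<in> ball p e" "v \<in> ball q r" "f v = E x" for x v
      using that g(2)[of v] by auto
  qed (use e r in auto)
qed

text \<open>
  A map into the complement of the singular values lifts, as for a covering map. There is a largest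
  disc \<open>ball 0 \<rho>\<close> with a lift. If its radius were below 1, the lift would converge along every radius,
  since otherwise the end point of the image would be an asymptotic value. So it could be continued
  across each boundary point by a local inverse of \<open>f\<close>, and by compactness to a larger disc.
\<close>

lemma holomorphic_lift_disc:
  assumes holo: "f holomorphic_on UNIV" and nc: "\<not> f constant_on UNIV"
    and E: "E holomorphic_on ball 0 1" and reg: "\<And>x. x \<in> ball 0 1 \<Longrightarrow> E x \<notin> sing_inv f"
    and z0: "f z0 = E 0"
  obtains h where "h holomorphic_on ball 0 1" "h 0 = z0" "\<And>x. x \<in> ball 0 1 \<Longrightarrow> f (h x) = E x"
proof -
  have crit: "deriv f z \<noteq> 0" if "x \<in> ball 0 1" "f z = E x" for x z
    using reg[OF that(1)] that(2) unfolding sing_inv_def critical_values_def by (metis (mono_tags, lifting) UnCI image_eqI mem_Collect_eq)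
  define lift where "lift h r \<longleftrightarrow> h holomorphic_on ball 0 r \<and> h 0 = z0 \<and> (\<forall>x\<in>ball 0 r. f (h x) = E x)"
    for h r
  have uniq: "h1 x = h2 x" if "connected S" "S \<subseteq> ball 0 1" "h1 holomorphic_on S" "h2 holomorphic_on S"
     "\<And>x. x \<in> S \<Longrightarrow> f (h1 x) = E x" "\<And>x. x \<in> S \<Longrightarrow> f (h2 x) = E x" "y \<in> S" "h1 y = h2 y" "x \<in> S"
     for S h1 h2 x y
    by (rule lifts_unique[OF holo that(1) that(3)[THEN holomorphic_on_imp_continuous_on]
          that(4)[THEN holomorphic_on_imp_continuous_on] _ _ that(7,8,9)])
       (use that(2,5,6) crit in auto)
  define G where "G = {r. 0 < r \<and> r \<le> 1 \<and> (\<exists>h. lift h r)}"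
  have Gne: "G \<noteq> {}"
  proof -
    have z: "(0::complex) \<in> ball 0 1" by simp
    obtain e k V where k: "e > 0" "ball 0 e \<subseteq> ball (0::complex) 1" "k holomorphic_on ball 0 e" "open V" "z0 \<in> V"
      "\<And>x. x \<in> ball 0 e \<Longrightarrow> f (k x) = E x"
      "\<And>x v. x \<in> ball 0 e \<Longrightarrow> v \<in> V \<Longrightarrow> f v = E x \<Longrightarrow> v = k x"
      by (rule local_lift[OF holo E open_ball z z0 crit[OF z z0]]) (rule that; assumption)
    have "lift k (min e 1)" unfolding lift_def
      using k(6) k(7)[of 0 z0] k(1,5) z0 by (auto intro!: holomorphic_on_subset[OF k(3)])
    then have "min e 1 \<in> G" using k(1) by (auto simp: G_def)
    then show ?thesis by blast
  qed
  define \<rho> where "\<rho> = Sup G"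
  have bdd: "bdd_above G" by (auto simp: G_def bdd_above_def)
  have \<rho>: "0 < \<rho>" "\<rho> \<le> 1"
  proof -
    obtain r where "r \<in> G" using Gne by blast
    moreover from this have "r > 0" by (simp add: G_def)
    ultimately show "0 < \<rho>" using cSup_upper[OF _ bdd, of r] unfolding \<rho>_def by linarith
    show "\<rho> \<le> 1" unfolding \<rho>_def by (rule cSup_least[OF Gne]) (simp add: G_def)
  qed
  have "\<forall>r\<in>G. \<exists>h. lift h r" by (simp add: G_def)
  from bchoice[OF this] obtain H where "\<forall>r\<in>G. lift (H r) r" ..
  then have H: "\<And>r. r \<in> G \<Longrightarrow> lift (H r) r" by simp
  have below_\<rho>: "y < \<rho> \<longleftrightarrow> (\<exists>r\<in>G. y < r)" for y
    unfolding \<rho>_def by (rule less_cSup_iff[OF Gne bdd])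
  obtain h where h: "h holomorphic_on (\<Union>r\<in>G. ball 0 r)" "\<And>r x. r \<in> G \<Longrightarrow> x \<in> ball 0 r \<Longrightarrow> h x = H r x"
  proof (rule holomorphic_glue[of G "ball 0" H])
    fix i j x assume ij: "i \<in> G" "j \<in> G" "x \<in> ball (0::complex) i" "x \<in> ball 0 j"
    show "H i x = H j x"
      by (rule uniq[of "ball 0 (min i j)" _ _ 0])
         (use ij H[of i] H[of j] in \<open>auto simp: lift_def G_def intro: holomorphic_on_subset\<close>)
  qed (use H in \<open>auto simp: lift_def\<close>)
  have "(\<Union>r\<in>G. ball 0 r) = ball (0::complex) \<rho>"
    by (auto simp: below_\<rho>)
  with h have hh: "h holomorphic_on ball 0 \<rho>" by simp
  have h0: "h 0 = z0" using h(2)[of _ 0] H Gne by (auto simp: lift_def G_def)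
  have hE: "f (h x) = E x" if x: "x \<in> ball 0 \<rho>" for x
  proof -
    obtain r where "r \<in> G" "x \<in> ball 0 r" using x by (auto simp: below_\<rho>)
    then show ?thesis using h(2) H by (auto simp: lift_def)
  qed
  have "\<rho> = 1"
  proof (rule ccontr)
    assume "\<rho> \<noteq> 1"
    then have \<rho>1: "\<rho> < 1" using \<rho> by simp
    have "\<exists>e k. e > 0 \<and> ball p e \<subseteq> ball 0 1 \<and> k holomorphic_on ball p e \<and> (\<forall>x\<in>ball p e. f (k x) = E x)
         \<and> (\<forall>x\<in>ball p e \<inter> ball 0 \<rho>. k x = h x)" if p: "p \<in> sphere 0 \<rho>" for p
    proof -
      \<comment> \<open>A radius of the disc, parametrised by \<open>{0..}\<close> as in the definition of asymptotic values.\<close>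
      define s where "s t = complex_of_real (1 - exp (-t)) * p" for t
      define \<gamma> where "\<gamma> t = h (s t)" for t
      have sb: "s t \<in> ball 0 \<rho>" if "t \<ge> 0" for t
      proof -
        have "\<bar>1 - exp (-t)\<bar> < 1" using that by simp
        then show ?thesis using p \<rho>(1) by (simp add: s_def norm_mult del: of_real_diff)
      qed
      have "((\<lambda>t::real. 1 - exp (-t)) \<longlongrightarrow> 1 - 0) at_top"
        by (intro tendsto_intros filterlim_compose[OF exp_at_bot] filterlim_uminus_at_bot_at_top)
      from tendsto_mult[OF tendsto_of_real[OF this] tendsto_const[of p]]
      have slim: "(s \<longlongrightarrow> p) at_top" unfolding s_def by simp
      have "continuous_on {0..} s" unfolding s_def by (intro continuous_intros)
      then have \<gamma>c: "continuous_on {0..} \<gamma>" unfolding \<gamma>_def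
        by (intro continuous_on_compose2[OF holomorphic_on_imp_continuous_on[OF hh]]) (use sb in auto)
      have pin: "p \<in> ball 0 1" using p \<rho>1 by simp
      have "isCont E p" using pin holomorphic_on_imp_continuous_on[OF E] continuous_on_eq_continuous_at open_ball by blast
      then have "((\<lambda>t. E (s t)) \<longlongrightarrow> E p) at_top" using slim isCont_tendsto_compose by blast
      then have flim: "((\<lambda>t. f (\<gamma> t)) \<longlongrightarrow> E p) at_top"
        by (rule Lim_transform_eventually)
           (use sb hE in \<open>auto simp: \<gamma>_def intro!: eventually_mono[OF eventually_ge_at_top[of 0]]\<close>)
      have "\<not> filterlim \<gamma> at_infinity at_top"
        using reg[OF pin] \<gamma>c flim unfolding sing_inv_def asymptotic_values_def by blast
      then obtain q where q: "(\<gamma> \<longlongrightarrow> q) at_top" "f q = E p"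
        using tendsto_of_image_tendsto[OF holo nc \<gamma>c flim] by blast
      obtain e k V where k: "e > 0" "ball p e \<subseteq> ball 0 1" "k holomorphic_on ball p e" "open V" "q \<in> V"
        "\<And>x. x \<in> ball p e \<Longrightarrow> f (k x) = E x"
        "\<And>x v. x \<in> ball p e \<Longrightarrow> v \<in> V \<Longrightarrow> f v = E x \<Longrightarrow> v = k x"
        by (rule local_lift[OF holo E open_ball pin q(2) crit[OF pin q(2)]]) (rule that; assumption)
      have "eventually (\<lambda>t. \<gamma> t \<in> V) at_top" using q(1) k(4,5) topological_tendstoD by blast
      moreover have "eventually (\<lambda>t. s t \<in> ball p e) at_top"
        using topological_tendstoD[OF slim open_ball, of p e] k(1) by auto
      moreover have "eventually (\<lambda>t. (t::real) \<ge> 0) at_top" by (rule eventually_ge_at_top)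
      ultimately have "eventually (\<lambda>t. \<gamma> t \<in> V \<and> s t \<in> ball p e \<and> s t \<in> ball 0 \<rho>) at_top"
        by eventually_elim (use sb in auto)
      then obtain t where t: "\<gamma> t \<in> V" "s t \<in> ball p e" "s t \<in> ball 0 \<rho>"
        using eventually_happens trivial_limit_at_top_linorder by blast
      have eq: "h (s t) = k (s t)" using k(7)[OF t(2,1)] hE[OF t(3)] by (simp add: \<gamma>_def)
      have "k x = h x" if "x \<in> ball p e \<inter> ball 0 \<rho>" for x
        by (rule uniq[of "ball p e \<inter> ball 0 \<rho>" _ _ "s t"])
           (use k t eq that hE in \<open>auto intro!: convex_connected convex_Int
             holomorphic_on_subset[OF k(3)] holomorphic_on_subset[OF hh]\<close>)
      with k show ?thesis by blast
    qed
    then obtain e k where ek: "\<And>p. p \<in> sphere 0 \<rho> \<Longrightarrow> e p > 0 \<and> ball p (e p) \<subseteq> ball 0 1 \<and>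
        k p holomorphic_on ball p (e p) \<and> (\<forall>x\<in>ball p (e p). f (k p x) = E x)
         \<and> (\<forall>x\<in>ball p (e p) \<inter> ball 0 \<rho>. k p x = h x)"
      by metis
    \<comment> \<open>The index 0 stands for the lift on the disc itself; it is not on the sphere.\<close>
    define U where "U p = (if p = 0 then ball 0 \<rho> else ball p (e p))" for p
    define K where "K p = (if p = 0 then h else k p)" for p
    define I where "I = insert 0 (sphere (0::complex) \<rho>)"
    have nz: "p \<noteq> 0" if "p \<in> sphere 0 \<rho>" for p :: complex using that \<rho> by auto
    have agree: "k p x = k p' x" if p: "p \<in> sphere 0 \<rho>" "p' \<in> sphere 0 \<rho>" and x: "x \<in> ball p (e p)" "x \<in> ball p' (e p')"
      for p p' x
    proof (cases "p = p'")
      case False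
      \<comment> \<open>Two overlapping discs centred at distinct boundary points have a common point on the chord
        between the centres, which lies inside the disc. There both continuations agree with \<open>h\<close>.\<close>
      define \<sigma> where "\<sigma> = e p / (e p + e p')"
      have e: "e p > 0" "e p' > 0" using ek p by auto
      have dd: "dist p p' < e p + e p'" using x dist_triangle[of p p' x] by (simp add: dist_commute)
      have \<sigma>: "0 < \<sigma>" "\<sigma> < 1" "1 - \<sigma> = e p' / (e p + e p')" using e by (auto simp: \<sigma>_def field_simps)
      define m where "m = (1 - \<sigma>) *\<^sub>R p + \<sigma> *\<^sub>R p'"
      have "m \<in> open_segment p p'" using \<sigma> False unfolding in_segment m_def by blast
      then have "dist 0 m < dist 0 p \<or> dist 0 m < dist 0 p'" by (rule dist_decreases_open_segment)
      then have m\<rho>: "m \<in> ball 0 \<rho>" using p by auto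
      have "p - m = \<sigma> *\<^sub>R (p - p')" "p' - m = (1 - \<sigma>) *\<^sub>R (p' - p)"
        by (auto simp: m_def algebra_simps)
      then have dm: "dist p m = \<sigma> * dist p p'" "dist p' m = (1 - \<sigma>) * dist p p'"
        using \<sigma> e by (simp_all add: dist_norm norm_minus_commute)
      have "dist p m < e p" using dm(1) dd e by (simp add: \<sigma>_def divide_less_eq mult_less_cancel_left_pos mult.commute)
      moreover have "dist p' m < e p'" using dm(2) dd e unfolding \<sigma>(3) by (simp add: divide_less_eq mult.commute)
      ultimately have m: "m \<in> ball p (e p) \<inter> ball p' (e p')" by simp
      then have km: "k p m = k p' m" using ek[OF p(1)] ek[OF p(2)] m\<rho> by auto
      show ?thesis
      proof (rule uniq[of "ball p (e p) \<inter> ball p' (e p')" "k p" "k p'" m])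
        show "connected (ball p (e p) \<inter> ball p' (e p'))" by (intro convex_connected convex_Int convex_ball)
        show "ball p (e p) \<inter> ball p' (e p') \<subseteq> ball 0 1" using ek[OF p(1)] by blast
        show "k p holomorphic_on ball p (e p) \<inter> ball p' (e p')"
          using ek[OF p(1)] by (blast intro: holomorphic_on_subset)
        show "k p' holomorphic_on ball p (e p) \<inter> ball p' (e p')"
          using ek[OF p(2)] by (blast intro: holomorphic_on_subset)
        show "f (k p y) = E y" "f (k p' y) = E y" if "y \<in> ball p (e p) \<inter> ball p' (e p')" for y
          using that ek[OF p(1)] ek[OF p(2)] by blast+
      qed (use m x km in auto)
    qed simp
    have UK0: "U 0 = ball 0 \<rho>" "K 0 = h" by (simp_all add: U_def K_def)
    have UKp: "U p = ball p (e p)" "K p = k p" if "p \<in> sphere 0 \<rho>" for p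
      using nz[OF that] by (simp_all add: U_def K_def)
    have I_cases: "i = 0 \<or> i \<in> sphere 0 \<rho>" if "i \<in> I" for i using that by (simp add: I_def)
    have KU_hol: "K i holomorphic_on U i" if "i \<in> I" for i
      using I_cases[OF that]
    proof
      assume "i \<in> sphere 0 \<rho>"
      then show ?thesis using ek[of i] by (simp only: UKp)
    qed (simp add: UK0 hh)
    have KE: "f (K i x) = E x" if i: "i \<in> I" and x: "x \<in> U i" for i x
      using I_cases[OF i]
    proof
      assume "i \<in> sphere 0 \<rho>"
      then show ?thesis using ek[of i] x by (simp only: UKp)
    qed (use x hE in \<open>simp add: UK0\<close>)
    have K_agree: "K i x = K j x" if ij: "i \<in> I" "j \<in> I" and x: "x \<in> U i" "x \<in> U j" for i j x
    proof -
      have aux: "K 0 x = K l x" if l: "l \<in> sphere 0 \<rho>" and "x \<in> U 0" "x \<in> U l" for l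
        using ek[OF l] that(2,3) unfolding UK0 UKp[OF l] by simp
      from I_cases[OF ij(1)] show ?thesis
      proof
        assume i0: "i = 0"
        from I_cases[OF ij(2)] show ?thesis using aux[of j] x i0 by auto
      next
        assume ip: "i \<in> sphere 0 \<rho>"
        from I_cases[OF ij(2)] show ?thesis
        proof
          assume "j = 0" then show ?thesis using aux[OF ip] x by simp
        next
          assume jp: "j \<in> sphere 0 \<rho>"
          show ?thesis using agree[OF ip jp] x unfolding UKp[OF ip] UKp[OF jp] .
        qed
      qed
    qed
    have U_open: "open (U i)" for i by (simp add: U_def)
    obtain g where g: "g holomorphic_on (\<Union>i\<in>I. U i)" "\<And>i x. i \<in> I \<Longrightarrow> x \<in> U i \<Longrightarrow> g x = K i x"
    proof (rule holomorphic_glue[of I U K])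
      show "open (U i)" if "i \<in> I" for i by (rule U_open)
      show "K i holomorphic_on U i" if "i \<in> I" for i using that by (rule KU_hol)
      show "K i x = K j x" if "i \<in> I" "j \<in> I" "x \<in> U i" "x \<in> U j" for i j x
        using that by (rule K_agree)
    qed (rule that; assumption)
    have gE: "f (g x) = E x" if x: "x \<in> (\<Union>i\<in>I. U i)" for x
    proof -
      obtain i where i: "i \<in> I" "x \<in> U i" using x by blast
      then show ?thesis using g(2)[OF i] KE[OF i] by simp
    qed
    have cb: "cball 0 \<rho> \<subseteq> (\<Union>i\<in>I. U i)"
    proof
      fix x :: complex assume "x \<in> cball 0 \<rho>"
      then consider "x \<in> ball 0 \<rho>" | "x \<in> sphere 0 \<rho>" by force
      then have "\<exists>i\<in>I. x \<in> U i"
      proof cases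
        case 1
        then show ?thesis by (intro bexI[of _ 0]) (simp_all add: UK0 I_def)
      next
        case 2
        then have "x \<in> U x" using ek[OF 2] by (simp add: UKp)
        with 2 show ?thesis by (intro bexI[of _ x]) (simp_all add: I_def)
      qed
      then show "x \<in> (\<Union>i\<in>I. U i)" by blast
    qed
    have "open (\<Union>i\<in>I. U i)" using U_open by blast
    with cb obtain d where d: "d > 0" "(\<Union>x\<in>cball 0 \<rho>. ball x d) \<subseteq> (\<Union>i\<in>I. U i)"
      using compact_subset_open_imp_ball_epsilon_subset[OF compact_cball] by metis
    define \<rho>' where "\<rho>' = min 1 (\<rho> + d)"
    have sub: "ball 0 \<rho>' \<subseteq> (\<Union>i\<in>I. U i)"
    proof
      fix x :: complex assume x: "x \<in> ball 0 \<rho>'"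
      show "x \<in> (\<Union>i\<in>I. U i)"
      proof (cases "norm x \<le> \<rho>")
        case True then show ?thesis using cb by auto
      next
        case False
        define y where "y = (\<rho> / norm x) *\<^sub>R x"
        have nx: "norm x > \<rho>" "norm x > 0" using False \<rho> by auto
        have ny: "norm y = \<rho>" using nx \<rho> by (simp add: y_def)
        have "x - y = (1 - \<rho> / norm x) *\<^sub>R x" by (simp add: y_def algebra_simps)
        then have "dist y x = \<bar>1 - \<rho> / norm x\<bar> * norm x" by (simp add: dist_norm norm_minus_commute)
        moreover have "0 \<le> 1 - \<rho> / norm x" using nx \<rho> by simp
        ultimately have "dist y x = norm x - \<rho>" using nx by (simp add: left_diff_distrib)
        with ny have "y \<in> cball 0 \<rho>" "x \<in> ball y d" using x nx by (auto simp: \<rho>'_def)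
        then show ?thesis using d(2) by blast
      qed
    qed
    have "0 \<in> I" "0 \<in> U 0" using \<rho>(1) by (simp_all add: I_def UK0)
    then have "g 0 = z0" using g(2) h0 by (simp add: UK0)
    moreover have "f (g x) = E x" if "x \<in> ball 0 \<rho>'" for x using gE subsetD[OF sub that] .
    ultimately have "lift g \<rho>'"
      unfolding lift_def using holomorphic_on_subset[OF g(1) sub] by blast
    then have "\<rho>' \<in> G" using \<rho> d by (auto simp: G_def \<rho>'_def)
    then have "\<rho>' \<le> \<rho>" using bdd unfolding \<rho>_def by (simp add: cSup_upper)
    then show False using d \<rho>1 by (auto simp: \<rho>'_def min_def split: if_splits)
  qed
  with hh h0 hE show ?thesis by (auto intro: that)
qed

section \<open>Inverse branches in logarithmic coordinates\<close>

lemma filterlim_at_infinity_imp_poly: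
  assumes "f holomorphic_on UNIV" "filterlim f at_infinity at_infinity"
  shows "\<exists>p. f = poly p"
proof -
  have "((inverse \<circ> f) \<longlongrightarrow> 0) at_infinity"
    unfolding o_def by (rule filterlim_compose[OF tendsto_inverse_0 assms(2)])
  then obtain a n where a: "\<And>z. f z = (\<Sum>i\<le>n. a i * z ^ i)"
    by (rule pole_at_infinity[OF assms(1)]) (rule that; assumption)
  have "f = poly (\<Sum>i\<le>n. monom (a i) i)"
    by (rule ext) (simp add: a poly_sum poly_monom)
  then show ?thesis by blast
qed

lemma exp_eqD:
  fixes w z :: complex
  assumes "exp w = exp z"
  obtains m :: int where "w = z + 2 * of_int m * of_real pi * \<i>"
proof -
  obtain m :: int where "w = z + complex_of_real (real_of_int (2 * m) * pi) * \<i>" using assms unfolding exp_eq by blast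
  then show ?thesis by (intro that[of m]) simp
qed

text \<open>
  The standing assumption: \<open>f\<close> is a transcendental entire function, and its singular values and \<open>f 0\<close>
  lie in the disc of radius \<open>R0\<close>. The condition on \<open>f 0\<close> keeps the preimage of the exterior of that disc
  away from the origin, so that logarithms can be taken there.
\<close>

locale sing_inv_in_disc =
  fixes f :: "complex \<Rightarrow> complex" and R0 :: real
  assumes entire: "f holomorphic_on UNIV" and not_poly: "\<not> (\<exists>p. f = poly p)"
    and f_0: "cmod (f 0) < R0" and sing: "\<And>w. w \<in> sing_inv f \<Longrightarrow> cmod w < R0"
begin

definition H :: "complex set" where "H = {W. ln R0 < Re W}"

definition inverse_branch :: "(complex \<Rightarrow> complex) \<Rightarrow> bool" where
  "inverse_branch K \<longleftrightarrow> K holomorphic_on H \<and> (\<forall>V\<in>H. f (exp (K V)) = exp V)"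

lemma R0_pos: "R0 > 0" using f_0 norm_ge_zero[of "f 0"] by linarith

lemma in_H_iff: "W \<in> H \<longleftrightarrow> R0 < cmod (exp W)"
proof -
  have "W \<in> H \<longleftrightarrow> exp (ln R0) < exp (Re W)" by (simp only: H_def mem_Collect_eq exp_less_cancel_iff)
  then show ?thesis using R0_pos by simp
qed

lemma open_H: "open H" unfolding H_def by (rule open_halfspace_Re_gt)

lemma convex_H: "convex H" unfolding H_def by (rule convex_halfspace_Re_gt)

lemma H_shift: "W \<in> H \<Longrightarrow> W + 2 * of_int m * of_real pi * \<i> \<in> H"
  by (simp add: H_def)

lemma not_constant: "\<not> f constant_on UNIV"
proof
  assume "f constant_on UNIV"
  then obtain c where "\<And>z. f z = c" unfolding constant_on_def by auto
  then have "f = poly [:c:]" by (intro ext) simp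
  then show False using not_poly by blast
qed

lemma not_sing: "W \<in> H \<Longrightarrow> exp W \<notin> sing_inv f"
  using sing[of "exp W"] in_H_iff[of W] by force

lemma entire_f_exp: "(\<lambda>z. f (exp z)) holomorphic_on UNIV"
  by (rule holomorphic_on_compose_gen[of exp _ f UNIV, unfolded o_def])
     (auto intro!: holomorphic_intros entire)

lemma deriv_f_exp_nonzero:
  assumes "V \<in> H" "f (exp z) = exp V"
  shows "deriv (\<lambda>z. f (exp z)) z \<noteq> 0"
proof -
  have "exp V \<notin> critical_values f" using not_sing[OF assms(1)] by (simp add: sing_inv_def)
  then have "deriv f (exp z) \<noteq> 0" using assms(2) unfolding critical_values_def by force
  moreover have "((\<lambda>z. f (exp z)) has_field_derivative deriv f (exp z) * exp z) (at z)"
    by (rule DERIV_chain2[OF holomorphic_derivI[OF entire open_UNIV UNIV_I] DERIV_exp])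
  ultimately show ?thesis by (simp add: DERIV_imp_deriv)
qed

text \<open>
  A Moebius transformation \<open>M\<close> from the unit disc onto \<open>H\<close> with \<open>M 0 = W\<close> reduces this to the lifting
  lemma for the disc. The lift avoids the origin and hence has a logarithm.
\<close>

lemma inverse_branch_exists:
  assumes W: "W \<in> H" and \<zeta>: "f (exp \<zeta>) = exp W"
  obtains K where "inverse_branch K" "K W = \<zeta>"
proof -
  define c where "c = Re W - ln R0"
  have c: "c > 0" using W by (simp add: c_def H_def)
  define M where "M x = W + 2 * c * x / (1 - x)" for x :: complex
  define N where "N V = (V - W) / (V - W + 2 * c)" for V :: complex
  have MH: "M x \<in> H" if x: "x \<in> ball 0 1" for x
  proof -
    have x1: "cmod x < 1" "x \<noteq> 1" using x by auto
    have e: "2 * x / (1 - x) = (1 + x) / (1 - x) - 1" using x1 by (simp add: field_simps)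
    have "Re ((1 + x) / (1 - x)) = Re ((1 + x) * cnj (1 - x)) / (cmod (1 - x))\<^sup>2"
      by (subst complex_div_cnj) (simp add: Re_divide_of_real[symmetric] del: Re_divide_of_real)
    also have "Re ((1 + x) * cnj (1 - x)) = 1 - (cmod x)\<^sup>2"
      unfolding cmod_power2 by (simp add: algebra_simps power2_eq_square)
    finally have "Re ((1 + x) / (1 - x)) > 0" using x1 by (simp add: abs_square_less_1)
    then have "- 1 < Re (2 * x / (1 - x))" unfolding e by simp
    then have "- c < c * Re (2 * x / (1 - x))" using c by (metis mult_less_cancel_left_pos mult_minus1_right)
    moreover have "Re (M x) = Re W + c * Re (2 * x / (1 - x))"
    proof -
      have "M x = W + of_real c * (2 * x / (1 - x))" by (simp add: M_def)
      then show ?thesis by (simp only: plus_complex.simps Re_complex_of_real times_complex.simps Im_complex_of_real mult_zero_left diff_zero)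
    qed
    ultimately show ?thesis by (simp add: H_def c_def)
  qed
  have den: "V - W + 2 * c \<noteq> 0" if "V \<in> H" for V
  proof
    assume "V - W + 2 * c = 0"
    then have "Re (V - W + 2 * c) = 0" by simp
    then show False using that c by (simp add: H_def c_def)
  qed
  have Nb: "N V \<in> ball 0 1" if V: "V \<in> H" for V
  proof -
    have "(cmod (V - W))\<^sup>2 < (cmod (V - W + 2 * c))\<^sup>2"
    proof -
      have "0 < 4 * c * (Re (V - W) + c)" using V c by (simp add: H_def c_def)
      then show ?thesis unfolding cmod_power2 by (simp add: power2_eq_square algebra_simps)
    qed
    then have "cmod (V - W) < cmod (V - W + 2 * c)" by (rule power_less_imp_less_base) simp
    then show ?thesis by (simp add: N_def norm_divide divide_less_eq)
  qed
  have MN: "M (N V) = V" if V: "V \<in> H" for V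
  proof -
    have "1 - N V = 2 * c / (V - W + 2 * c)" using den[OF V] by (simp add: N_def field_simps)
    then show ?thesis using den[OF V] c by (simp add: M_def) (simp add: N_def)
  qed
  have M0: "M 0 = W" by (simp add: M_def)
  have NW: "N W = 0" by (simp add: N_def)
  have "(\<lambda>x. exp (M x)) holomorphic_on ball 0 1"
    unfolding M_def by (intro holomorphic_intros) auto
  then obtain h where h: "h holomorphic_on ball 0 1" "h 0 = exp \<zeta>" "\<And>x. x \<in> ball 0 1 \<Longrightarrow> f (h x) = exp (M x)"
    by (rule holomorphic_lift_disc[OF entire not_constant])
       (use not_sing[OF MH] \<zeta> M0 in \<open>auto intro: that\<close>)
  have hN: "(\<lambda>V. h (N V)) holomorphic_on H"
    using Nb den unfolding N_def
    by (intro holomorphic_on_compose_gen[of "\<lambda>V. (V - W) / (V - W + 2 * c)" _ h "ball 0 1", unfolded o_def])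
       (auto intro!: holomorphic_intros h(1))
  have fh: "f (h (N V)) = exp V" if "V \<in> H" for V using h(3)[OF Nb[OF that]] MN[OF that] by simp
  have "h (N V) \<noteq> 0" if "V \<in> H" for V
    using fh[OF that] f_0 that in_H_iff[of V] by auto
  then obtain l where l: "l holomorphic_on H" "\<And>V. V \<in> H \<Longrightarrow> exp (l V) = h (N V)"
    using holomorphic_log_convex[OF open_H convex_H hN] by metis
  define K where "K V = l V + (\<zeta> - l W)" for V
  have "exp (K V) = h (N V)" if "V \<in> H" for V
    using l(2)[OF that] l(2)[OF W] NW h(2) by (simp add: K_def exp_add exp_diff)
  moreover have "K holomorphic_on H" unfolding K_def by (intro holomorphic_intros l)
  ultimately have "inverse_branch K" unfolding inverse_branch_def using fh by simp
  moreover have "K W = \<zeta>" by (simp add: K_def)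
  ultimately show ?thesis by (rule that)
qed

lemma inverse_branch_unique:
  assumes "inverse_branch K1" "inverse_branch K2" "V \<in> H" "K1 V = K2 V" "W \<in> H"
  shows "K1 W = K2 W"
  by (rule lifts_unique[OF entire_f_exp convex_connected[OF convex_H], of K1 K2 V W])
     (use assms deriv_f_exp_nonzero in \<open>auto simp: inverse_branch_def holomorphic_on_imp_continuous_on\<close>)

lemma exp_plus_2pin: "exp (W + 2 * of_int m * of_real pi * \<i>) = exp W"
  unfolding exp_eq by (rule exI[of _ m]) simp

lemma inverse_branch_shift:
  assumes "inverse_branch K"
  shows "inverse_branch (\<lambda>V. K (V + 2 * of_int m * of_real pi * \<i>) + 2 * of_int n * of_real pi * \<i>)"
  unfolding inverse_branch_def
proof (intro conjI ballI)
  have "(\<lambda>V. K (V + 2 * of_int m * of_real pi * \<i>)) holomorphic_on H"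
    by (rule holomorphic_on_compose_gen[of "\<lambda>V. V + 2 * of_int m * of_real pi * \<i>" _ K H, unfolded o_def])
       (use assms H_shift in \<open>auto simp: inverse_branch_def intro!: holomorphic_intros\<close>)
  then show "(\<lambda>V. K (V + 2 * of_int m * of_real pi * \<i>) + 2 * of_int n * of_real pi * \<i>) holomorphic_on H"
    by (intro holomorphic_intros)
  show "f (exp (K (V + 2 * of_int m * of_real pi * \<i>) + 2 * of_int n * of_real pi * \<i>)) = exp V" if "V \<in> H" for V
    using assms H_shift[OF that] unfolding exp_plus_2pin inverse_branch_def by (simp only: exp_plus_2pin)
qed

text \<open>
  \<open>f\<close> is bounded on compact sets, so points with a large image are large.
\<close>

lemma inverse_branch_large:
  assumes K: "inverse_branch K"
  obtains M where "\<And>V. V \<in> H \<Longrightarrow> M < Re V \<Longrightarrow> B < cmod (exp (K V))"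
proof -
  have "bounded (f ` cball 0 B)"
    using compact_imp_bounded[OF compact_continuous_image[OF _ compact_cball]]
      holomorphic_on_imp_continuous_on[OF entire] continuous_on_subset by blast
  then obtain D where D: "D > 0" "\<And>z. z \<in> cball 0 B \<Longrightarrow> cmod (f z) \<le> D"
    unfolding bounded_pos by auto
  show ?thesis
  proof (rule that[of "ln D"])
    fix V assume V: "V \<in> H" "ln D < Re V"
    show "B < cmod (exp (K V))"
    proof (rule ccontr)
      assume "\<not> ?thesis"
      then have "cmod (f (exp (K V))) \<le> D" by (intro D) simp
      then have "exp (Re V) \<le> D" using K V(1) by (simp add: inverse_branch_def)
      then show False using V(2) D(1) by (metis exp_gt_zero ln_exp ln_le_cancel_iff not_le)
    qed
  qed
qed

text \<open>
  Otherwise \<open>k = exp \<circ> K\<close> has period \<open>2 pi i m\<close>, and \<open>q w = 1 / k (- m Ln w)\<close> is well defined and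
  holomorphic in a punctured disc, with limit 0 at the puncture. Then \<open>q\<close> is open, so every large \<open>z\<close>
  is \<open>1 / q w\<close> for some small \<open>w\<close>, whence \<open>f z = w ^ (-m)\<close> is large. An entire function that
  tends to infinity at infinity is a polynomial.
\<close>

lemma exp_inverse_branch_not_periodic_pos:
  fixes m :: int
  assumes K: "inverse_branch K" and V0: "V0 \<in> H"
    and eq: "exp (K (V0 + 2 * of_int m * of_real pi * \<i>)) = exp (K V0)"
  shows "\<not> m > 0"
proof
  assume m: "m > 0"
  define k where "k V = exp (K V)" for V
  obtain n where n: "K (V0 + 2 * of_int m * of_real pi * \<i>) = K V0 + 2 * of_int n * of_real pi * \<i>"
    using eq by (rule exp_eqD) (rule that; assumption)
  have k1: "k (V + 2 * of_int m * of_real pi * \<i>) = k V" if "V \<in> H" for V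
  proof -
    have "K (V + 2 * of_int m * of_real pi * \<i>) + 2 * of_int 0 * of_real pi * \<i> =
          K (V + 2 * of_int 0 * of_real pi * \<i>) + 2 * of_int n * of_real pi * \<i>"
      by (rule inverse_branch_unique[OF inverse_branch_shift[OF K] inverse_branch_shift[OF K] V0 _ that])
         (simp add: n)
    then show ?thesis unfolding k_def by (metis add.right_neutral exp_plus_2pin mult_zero_left mult_zero_right of_int_0)
  qed
  have kn: "k (V + of_nat j * (2 * of_int m * of_real pi * \<i>)) = k V" if "V \<in> H" for V j
  proof (induction j)
    case (Suc j)
    have "V + of_nat j * (2 * of_int m * of_real pi * \<i>) \<in> H" using that by (simp add: H_def)
    from k1[OF this] Suc show ?case by (simp add: algebra_simps)
  qed simp
  have kz: "k (V + of_int j * (2 * of_int m * of_real pi * \<i>)) = k V" if V: "V \<in> H" for V j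
  proof (cases "j \<ge> 0")
    case True
    then show ?thesis using kn[OF V, of "nat j"] by simp
  next
    case False
    have "V + of_int j * (2 * of_int m * of_real pi * \<i>) \<in> H" using V by (simp add: H_def)
    from kn[OF this, of "nat (-j)"] False show ?thesis by simp
  qed
  define \<rho> where "\<rho> = exp (- ln R0 / m)"
  have \<rho>: "\<rho> > 0" by (simp add: \<rho>_def)
  have inH: "- of_int m * L \<in> H" if "cmod (exp L) < \<rho>" for L
  proof -
    have "Re L < - ln R0 / m" using that by (simp add: \<rho>_def)
    then have "ln R0 < - m * Re L" using m by (simp add: field_simps)
    then show ?thesis by (simp add: H_def)
  qed
  define q where "q w = (if w = 0 then 0 else inverse (k (- of_int m * Ln w)))" for w
  \<comment> \<open>Periodicity makes \<open>q\<close> independent of the choice of the logarithm, so that the cut of \<^const>\<open>Ln\<close> is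
    harmless.\<close>
  have q_any_log: "q (exp L) = inverse (k (- of_int m * L))" if "cmod (exp L) < \<rho>" for L
  proof -
    obtain j where "Ln (exp L) = L + 2 * of_int j * of_real pi * \<i>"
      using exp_eqD[of "Ln (exp L)" L] exp_Ln[OF exp_not_eq_zero] by metis
    then have "- of_int m * Ln (exp L) = - of_int m * L + of_int (-j) * (2 * of_int m * of_real pi * \<i>)"
      by (simp add: algebra_simps)
    then show ?thesis using kz[OF inH[OF that], of "-j"] by (simp add: q_def)
  qed
  have khol: "k holomorphic_on H" unfolding k_def using K by (auto simp: inverse_branch_def intro!: holomorphic_intros)
  have kne: "k V \<noteq> 0" for V by (simp add: k_def)
  have q_hol: "q holomorphic_on ball 0 \<rho> - {0}"
  proof -
    have "q field_differentiable at w" if w: "w \<in> ball 0 \<rho> - {0}" for w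
    proof -
      define S where "S = ball w (cmod w) \<inter> ball 0 \<rho>"
      have S: "open S" "convex S" "w \<in> S" "0 \<notin> S" using w by (auto simp: S_def intro: convex_Int)
      then obtain L where L: "L holomorphic_on S" "\<And>z. z \<in> S \<Longrightarrow> exp (L z) = z"
        using holomorphic_log_convex[of S "\<lambda>z. z"] by (metis holomorphic_on_ident)
      have SH: "- of_int m * L z \<in> H" if "z \<in> S" for z
        by (rule inH) (use L(2)[OF that] that in \<open>simp add: S_def\<close>)
      have "(\<lambda>z. k (- of_int m * L z)) holomorphic_on S"
        by (rule holomorphic_on_compose_gen[of "\<lambda>z. - of_int m * L z" _ k H, unfolded o_def])
           (use SH khol L(1) in \<open>auto intro!: holomorphic_intros\<close>)
      then have "(\<lambda>z. inverse (k (- of_int m * L z))) holomorphic_on S"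
        using kne by (intro holomorphic_intros) auto
      moreover have "inverse (k (- of_int m * L z)) = q z" if "z \<in> S" for z
        using q_any_log[of "L z"] L(2)[OF that] that by (simp add: S_def)
      ultimately have "q holomorphic_on S" by (rule holomorphic_transform)
      then show ?thesis using S(1,3) by (rule holomorphic_on_imp_differentiable_at)
    qed
    then show ?thesis by (simp add: holomorphic_on_def field_differentiable_at_within)
  qed
  have q_lim: "(q \<longlongrightarrow> 0) (at 0)"
  proof (rule tendstoI)
    fix e :: real assume e: "e > 0"
    obtain M where M: "\<And>V. V \<in> H \<Longrightarrow> M < Re V \<Longrightarrow> 1/e < cmod (exp (K V))"
      by (rule inverse_branch_large[OF K, of "1/e"]) (rule that; assumption)
    define d where "d = min \<rho> (exp (- M / m))"
    have "dist (q w) 0 < e" if w: "w \<noteq> 0" "cmod w < d" for w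
    proof -
      have "cmod w < exp (- M / m)" using w by (simp add: d_def)
      then have "ln (cmod w) < - M / m" using w by (metis exp_less_cancel_iff exp_ln zero_less_norm_iff)
      then have "Re (Ln w) < - M / m" using w by simp
      then have "M < Re (- of_int m * Ln w)" using m w by (simp add: field_simps)
      moreover have "- of_int m * Ln w \<in> H" by (rule inH) (use w in \<open>simp add: d_def\<close>)
      ultimately have "1/e < cmod (k (- of_int m * Ln w))" unfolding k_def by (intro M)
      then have "inverse (cmod (k (- of_int m * Ln w))) < inverse (1/e)"
        using e by (intro less_imp_inverse_less) auto
      then show ?thesis using w e by (simp add: q_def norm_inverse)
    qed
    moreover have "d > 0" using \<rho> by (simp add: d_def)
    ultimately show "eventually (\<lambda>w. dist (q w) 0 < e) (at 0)"
      unfolding eventually_at by (intro exI[of _ d]) auto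
  qed
  have q0: "q 0 = 0" by (simp add: q_def)
  have q_hol0: "q holomorphic_on ball 0 \<rho>"
  proof (rule no_isolated_singularity[of _ _ "{0}"])
    show "continuous_on (ball 0 \<rho>) q"
    proof (rule continuous_at_imp_continuous_on, rule ballI)
      fix w :: complex assume "w \<in> ball 0 \<rho>"
      show "isCont q w"
      proof (cases "w = 0")
        case True then show ?thesis using q_lim q0 by (simp add: isCont_def)
      next
        case False
        then show ?thesis
          using q_hol \<open>w \<in> ball 0 \<rho>\<close> continuous_on_eq_continuous_at[of "ball 0 \<rho> - {0}" q]
            holomorphic_on_imp_continuous_on by (metis DiffI open_ball open_delete singletonD)
      qed
    qed
  qed (use q_hol in auto)
  have "filterlim f at_infinity at_infinity"
    unfolding filterlim_at_infinity[OF order.refl]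
  proof (intro allI impI)
    fix B :: real assume B: "B > 0"
    define \<epsilon> where "\<epsilon> = min \<rho> (exp (- ln B / m))"
    have \<epsilon>: "\<epsilon> > 0" "\<epsilon> \<le> \<rho>" using \<rho> by (auto simp: \<epsilon>_def)
    have "open (q ` ball 0 \<epsilon>)"
    proof (rule open_mapping_thm[OF q_hol0])
      show "\<not> q constant_on ball 0 \<rho>"
      proof
        assume "q constant_on ball 0 \<rho>"
        moreover have "(0::complex) \<in> ball 0 \<rho>" "complex_of_real (\<rho>/2) \<in> ball 0 \<rho>" using \<rho> by auto
        ultimately have "q (complex_of_real (\<rho>/2)) = q 0" unfolding constant_on_def by metis
        then show False using \<rho> kne by (simp add: q_def)
      qed
    qed (use \<epsilon> in auto)
    moreover have "0 \<in> q ` ball 0 \<epsilon>" using q0 \<epsilon> by force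
    ultimately obtain d where d: "d > 0" "ball 0 d \<subseteq> q ` ball 0 \<epsilon>" unfolding open_contains_ball by blast
    have "B \<le> cmod (f z)" if z: "cmod z \<ge> 2/d" for z
    proof -
      have z0: "z \<noteq> 0" using z d(1) by auto
      have "2 / d > 0" using d(1) by simp
      then have "cmod (inverse z) \<le> inverse (2/d)" using z by (simp only: norm_inverse le_imp_inverse_le)
      also have "\<dots> < d" using d(1) by simp
      finally have "inverse z \<in> ball 0 d" by simp
      then obtain w where w: "w \<in> ball 0 \<epsilon>" "inverse z = q w" using d(2) by blast
      have w0: "w \<noteq> 0" using w(2) z0 q0 by (metis inverse_nonzero_iff_nonzero)
      have z_eq: "z = k (- of_int m * Ln w)" using w(2) w0 by (simp add: q_def)
      have wH: "- of_int m * Ln w \<in> H" by (rule inH) (use w w0 \<epsilon> in auto)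
      then have "f z = exp (- of_int m * Ln w)" using K unfolding z_eq k_def inverse_branch_def by blast
      then have fz: "cmod (f z) = exp (- m * ln (cmod w))" using w0 by simp
      have "cmod w < exp (- ln B / m)" using w by (simp add: \<epsilon>_def)
      then have "ln (cmod w) < - ln B / m" using w0 by (metis exp_less_cancel_iff exp_ln zero_less_norm_iff)
      then have "ln B < - m * ln (cmod w)" using m by (simp add: field_simps)
      then have "exp (ln B) < exp (- m * ln (cmod w))" by (simp only: exp_less_cancel_iff)
      then show ?thesis using fz B by simp
    qed
    then show "eventually (\<lambda>z. B \<le> cmod (f z)) at_infinity" unfolding eventually_at_infinity by blast
  qed
  then show False using filterlim_at_infinity_imp_poly[OF entire] not_poly by blast
qed

lemma exp_inverse_branch_not_periodic:
  fixes m :: int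
  assumes K: "inverse_branch K" and V: "V \<in> H"
    and eq: "exp (K (V + 2 * of_int m * of_real pi * \<i>)) = exp (K V)"
  shows "m = 0"
proof -
  have "\<not> m > 0" using exp_inverse_branch_not_periodic_pos[OF assms] .
  moreover have "\<not> - m > 0"
    by (rule exp_inverse_branch_not_periodic_pos[OF K H_shift[OF V, of m]]) (use eq in simp)
  ultimately show ?thesis by simp
qed

lemma inverse_branch_inj:
  assumes K: "inverse_branch K"
  shows "inj_on K H"
proof (rule inj_onI)
  fix V W assume VW: "V \<in> H" "W \<in> H" "K V = K W"
  then have "exp W = exp V" using K unfolding inverse_branch_def by metis
  then obtain m :: int where m: "W = V + 2 * of_int m * of_real pi * \<i>" by (rule exp_eqD)
  with VW have "m = 0" by (intro exp_inverse_branch_not_periodic[OF K VW(1)]) simp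
  with m show "V = W" by simp
qed

text \<open>
  If \<open>\<bar>f\<bar> > R0\<close> on the whole circle, the branch through one of its points maps a lift \<open>c\<close> of the
  image curve back to the circle. Going around once adds \<open>2 pi i\<close> to \<open>K \<circ> c\<close> and a multiple of
  \<open>2 pi i\<close> to \<open>c\<close>. Since \<open>exp \<circ> K\<close> is not periodic, that multiple is zero; but then \<open>c\<close> is closed and
  \<open>K \<circ> c\<close> is not.
\<close>

lemma circle_meets_small_values:
  assumes s: "s > 0"
  shows "\<exists>z. cmod z = s \<and> cmod (f z) \<le> R0"
proof (rule ccontr)
  assume none: "\<not> ?thesis"
  have big: "R0 < cmod (f z)" if "cmod z = s" for z
    by (rule ccontr) (use none that in force)
  define \<sigma> where "\<sigma> t = of_real (ln s) + \<i> * of_real t" for t :: real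
  have exp_\<sigma>: "cmod (exp (\<sigma> t)) = s" for t using s by (simp add: \<sigma>_def)
  have cont\<sigma>: "continuous_on {0..2*pi} \<sigma>" unfolding \<sigma>_def by (intro continuous_intros)
  have contf: "continuous_on {0..2*pi} (\<lambda>t. f (exp (\<sigma> t)))"
    by (rule continuous_on_compose2[OF holomorphic_on_imp_continuous_on[OF entire_f_exp] cont\<sigma>]) auto
  have nz: "f (exp (\<sigma> t)) \<noteq> 0" for t using big[OF exp_\<sigma>, of t] R0_pos by auto
  have "contractible {0..2*pi}" by (rule convex_imp_contractible) simp
  then obtain c where c: "continuous_on {0..2*pi} c" "\<And>t. t \<in> {0..2*pi} \<Longrightarrow> f (exp (\<sigma> t)) = exp (c t)"
    by (rule continuous_logarithm_on_contractible[OF contf _ nz]) (rule that; assumption)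
  have cH: "c t \<in> H" if "t \<in> {0..2*pi}" for t
    unfolding in_H_iff using c(2)[OF that] big[OF exp_\<sigma>[of t]] by simp
  have mem: "0 \<in> {0..2*pi}" "2*pi \<in> {0..2*pi}" by auto
  obtain K where K: "inverse_branch K" "K (c 0) = \<sigma> 0"
    by (rule inverse_branch_exists[OF cH[OF mem(1)] c(2)[OF mem(1)]]) (rule that; assumption)
  have "K (c (2*pi)) = \<sigma> (2*pi)"
  proof (rule lifts_unique[where ?h1.0 = "\<lambda>t. K (c t)" and ?h2.0 = \<sigma> and S = "{0..2*pi}" and ?x0.0 = 0,
          OF entire_f_exp])
    show "connected {0..2*pi}" by simp
    show "continuous_on {0..2*pi} (\<lambda>t. K (c t))"
      by (rule continuous_on_compose2[OF _ c(1)])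
         (use K(1) cH in \<open>auto simp: inverse_branch_def intro: holomorphic_on_imp_continuous_on\<close>)
    show "f (exp (K (c t))) = f (exp (\<sigma> t))" if "t \<in> {0..2*pi}" for t
      using K(1) cH[OF that] c(2)[OF that] by (simp add: inverse_branch_def)
    show "deriv (\<lambda>z. f (exp z)) (K (c t)) \<noteq> 0" if "t \<in> {0..2*pi}" for t
      by (rule deriv_f_exp_nonzero[OF cH[OF that]]) (use K(1) cH[OF that] in \<open>simp add: inverse_branch_def\<close>)
  qed (use cont\<sigma> K(2) in auto)
  then have K2: "K (c (2*pi)) = K (c 0) + 2 * of_int 1 * of_real pi * \<i>" using K(2) by (simp add: \<sigma>_def)
  have "\<sigma> (2*pi) = \<sigma> 0 + 2 * of_int 1 * of_real pi * \<i>" by (simp add: \<sigma>_def)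
  then have "exp (c (2*pi)) = exp (c 0)"
    using c(2)[OF mem(1)] c(2)[OF mem(2)] exp_plus_2pin[of "\<sigma> 0" 1] by simp
  then obtain m :: int where m: "c (2*pi) = c 0 + 2 * of_int m * of_real pi * \<i>" by (rule exp_eqD)
  have "m = 0"
    by (rule exp_inverse_branch_not_periodic[OF K(1) cH[OF mem(1)]])
       (use K2 m exp_plus_2pin[of "K (c 0)" 1] in simp)
  then show False using K2 m by simp
qed

text \<open>
  The bound 4 stands for \<open>pi\<close>: a vertical segment of length \<open>2 pi\<close> with centre \<open>p\<close> is mapped by
  \<^const>\<open>exp\<close> onto a circle around the origin.
\<close>

lemma vertical_segment_meets_small_values:
  obtains v where "cmod (v - p) < 4" "cmod (f (exp v)) \<le> R0"
proof -
  obtain z where z: "cmod z = cmod (exp p)" "cmod (f z) \<le> R0"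
    using circle_meets_small_values[of "cmod (exp p)"] by auto
  define t where "t = Arg (z / exp p)"
  have t: "\<bar>t\<bar> < 4" using Arg_bounded[of "z / exp p"] pi_less_4 by (auto simp: t_def)
  have "z \<noteq> 0" using z(1) by auto
  then have "z / exp p = of_real (cmod (z / exp p)) * exp (\<i> * of_real t)" unfolding t_def by (intro Arg_eq) simp
  also have "cmod (z / exp p) = 1" using z(1) by (simp add: norm_divide del: norm_exp_eq_Re)
  finally have "z = exp (p + \<i> * t)" by (simp add: exp_add field_simps)
  then show ?thesis using z t by (intro that[of "p + \<i> * t"]) (auto simp: norm_mult)
qed

lemma ball_subset_H: "r \<le> Re V - ln R0 \<Longrightarrow> ball V r \<subseteq> H"
proof
  fix W assume "r \<le> Re V - ln R0" "W \<in> ball V r"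
  then show "W \<in> H" using abs_Re_le_cmod[of "V - W"] by (auto simp: H_def dist_norm)
qed

text \<open>
  If the derivative were larger, then by Bloch's theorem the image of \<open>K\<close> would contain a disc of
  radius 4, and thus a point where \<open>\<bar>f \<circ> exp\<bar> \<le> R0\<close>. But \<open>\<bar>f (exp (K W))\<bar> = exp (Re W) > R0\<close>.
\<close>

lemma deriv_inverse_branch_bound:
  assumes K: "inverse_branch K" and V: "V \<in> H"
  shows "cmod (deriv K V) \<le> 48 / (Re V - ln R0)"
proof (rule ccontr)
  define r where "r = Re V - ln R0"
  have r: "r > 0" using V by (simp add: r_def H_def)
  assume "\<not> ?thesis"
  then have "4 \<le> r * cmod (deriv K V) / 12" using r by (simp add: r_def[symmetric] field_simps)
  moreover have sub: "ball V r \<subseteq> H" by (rule ball_subset_H) (simp add: r_def)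
  then have "K holomorphic_on ball V r" using K by (auto simp: inverse_branch_def intro: holomorphic_on_subset)
  ultimately obtain b where b: "ball b 4 \<subseteq> K ` ball V r" using Bloch[OF _ r] by metis
  obtain v where v: "cmod (v - b) < 4" "cmod (f (exp v)) \<le> R0"
    by (rule vertical_segment_meets_small_values)
  then have "v \<in> ball b 4" by (simp add: dist_norm norm_minus_commute)
  then obtain W where W: "W \<in> ball V r" "v = K W" using b by blast
  then have "W \<in> H" using sub by blast
  moreover from this have "f (exp v) = exp W" unfolding W(2) using K by (simp add: inverse_branch_def)
  ultimately show False using v(2) in_H_iff[of W] by simp
qed

end

context sing_inv_in_disc
begin

text \<open>
  Around a point far to the right, \<open>H\<close> contains a disc whose radius is large compared with \<open>M\<close>. So the
  derivative is small there, and by the distortion theorem nearly constant on the disc of radius \<open>M\<close>.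
\<close>

lemma inverse_branch_estimates:
  fixes \<kappa> M :: real
  assumes "\<kappa> > 0" "M > 0"
  obtains L where "L > ln R0"
    "\<And>K p. inverse_branch K \<Longrightarrow> L \<le> Re p \<Longrightarrow> cmod (deriv K p) \<le> \<kappa>"
    "\<And>K q q'. inverse_branch K \<Longrightarrow> L \<le> Re q \<Longrightarrow> L \<le> Re q' \<Longrightarrow> cmod (K q - K q') \<le> \<kappa> * cmod (q - q')"
    "\<And>K p q q'. inverse_branch K \<Longrightarrow> L \<le> Re p \<Longrightarrow> cmod (q - p) \<le> M \<Longrightarrow> cmod (q' - p) \<le> M \<Longrightarrow>
        cmod (K q - K q' - deriv K p * (q - q')) \<le> cmod (deriv K p) / 2 * cmod (q - q')"
proof -
  obtain C where C: "C > 0" "\<And>K p r v. r > 0 \<Longrightarrow> K holomorphic_on ball p r \<Longrightarrow> inj_on K (ball p r) \<Longrightarrow>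
     cmod (v - p) \<le> r / 4 \<Longrightarrow> cmod (deriv K v - deriv K p) \<le> C * (cmod (v - p) / r) * cmod (deriv K p)"
    by (rule univalent_distortion) (rule that; assumption)
  define L where "L = ln R0 + 48 / \<kappa> + 4 * M + 2 * C * M"
  have pos: "48 / \<kappa> > 0" "2 * C * M > 0" using assms C by auto
  have LH: "p \<in> H" if "L \<le> Re p" for p
    using that pos assms(2) unfolding L_def H_def mem_Collect_eq by linarith
  have der: "(K has_field_derivative deriv K p) (at p)" if "inverse_branch K" "p \<in> H" for K p
    using that by (intro holomorphic_derivI[OF _ open_H]) (auto simp: inverse_branch_def)
  have bound: "cmod (deriv K p) \<le> \<kappa>" if K: "inverse_branch K" and p: "L \<le> Re p" for K p
  proof -
    have r: "48 / \<kappa> \<le> Re p - ln R0" using p pos assms(2) unfolding L_def by linarith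
    have "cmod (deriv K p) \<le> 48 / (Re p - ln R0)" by (rule deriv_inverse_branch_bound[OF K LH[OF p]])
    also have "\<dots> \<le> 48 / (48 / \<kappa>)" 
      by (rule divide_left_mono[OF r _ mult_pos_pos]) (use r pos in linarith)+
    also have "\<dots> = \<kappa>" using assms by simp
    finally show ?thesis .
  qed
  have contr: "cmod (K q - K q') \<le> \<kappa> * cmod (q - q')" if K: "inverse_branch K" and q: "L \<le> Re q" "L \<le> Re q'" for K q q'
  proof (rule field_differentiable_bound[of "{z. L \<le> Re z}" K "deriv K"])
    show "convex {z. L \<le> Re z}" by (rule convex_halfspace_Re_ge)
    show "(K has_field_derivative deriv K z) (at z within {z. L \<le> Re z})" if "z \<in> {z. L \<le> Re z}" for z
      by (rule has_field_derivative_at_within, rule der[OF K LH]) (use that in simp)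
    show "cmod (deriv K z) \<le> \<kappa>" if "z \<in> {z. L \<le> Re z}" for z using that by (intro bound[OF K]) simp
  qed (use q in auto)
  have lin: "cmod (K q - K q' - deriv K p * (q - q')) \<le> cmod (deriv K p) / 2 * cmod (q - q')"
    if K: "inverse_branch K" and p: "L \<le> Re p" and q: "cmod (q - p) \<le> M" "cmod (q' - p) \<le> M" for K p q q'
  proof -
    define r where "r = Re p - ln R0"
    have r: "r \<ge> 4 * M" "r \<ge> 2 * C * M" "r > 0"
      using p pos assms(2) unfolding L_def r_def by linarith+
    have sub: "ball p r \<subseteq> H" by (rule ball_subset_H) (simp add: r_def)
    have hol: "K holomorphic_on ball p r" and inj: "inj_on K (ball p r)"
      using K sub inverse_branch_inj[OF K] by (auto simp: inverse_branch_def intro: holomorphic_on_subset inj_on_subset)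
    have near: "cmod (deriv K v - deriv K p) \<le> cmod (deriv K p) / 2" if v: "v \<in> cball p M" for v
    proof -
      have v': "cmod (v - p) \<le> M" using v by (simp add: dist_norm norm_minus_commute)
      have "cmod (deriv K v - deriv K p) \<le> C * (cmod (v - p) / r) * cmod (deriv K p)"
        by (rule C(2)[OF r(3) hol inj]) (use v' r in simp)
      also have "C * (cmod (v - p) / r) \<le> C * (M / r)"
        using v' r C by (intro mult_left_mono divide_right_mono) auto
      also have "C * (M / r) \<le> 1/2" using r by (simp add: field_simps)
      finally show ?thesis by (simp add: mult_right_mono)
    qed
    have cb: "cball p M \<subseteq> H" using sub r assms by (auto simp: subset_iff)
    have "cmod ((K q - deriv K p * q) - (K q' - deriv K p * q')) \<le> cmod (deriv K p) / 2 * cmod (q - q')"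
    proof (rule field_differentiable_bound[of "cball p M" "\<lambda>v. K v - deriv K p * v" "\<lambda>v. deriv K v - deriv K p"])
      show "((\<lambda>v. K v - deriv K p * v) has_field_derivative deriv K v - deriv K p) (at v within cball p M)"
        if "v \<in> cball p M" for v
        using der[OF K subsetD[OF cb that]]
        by (rule_tac has_field_derivative_at_within) (auto intro!: derivative_eq_intros)
    qed (use near q in \<open>auto simp: dist_norm norm_minus_commute\<close>)
    then show ?thesis by (simp add: algebra_simps)
  qed
  have "L > ln R0" using pos assms(2) unfolding L_def by linarith
  then show ?thesis using bound contr lin by (rule that)
qed

text \<open>
  The images of two inverse branches are disjoint unless the branches differ only by the choice of
  the logarithm of the argument.
\<close>

lemma inverse_branch_align:
  assumes K: "inverse_branch K" and K': "inverse_branch K'" and V: "V \<in> H" "V' \<in> H" and eq: "K V = K' V'"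
  obtains m :: int where "V = V' + 2 * of_int m * of_real pi * \<i>"
    "\<And>W. W \<in> H \<Longrightarrow> K' W = K (W + 2 * of_int m * of_real pi * \<i>)"
proof -
  have "exp V = exp V'" using K K' V eq unfolding inverse_branch_def by metis
  then obtain m :: int where m: "V = V' + 2 * of_int m * of_real pi * \<i>" by (rule exp_eqD)
  have "K' W = K (W + 2 * of_int m * of_real pi * \<i>)" if "W \<in> H" for W
    using inverse_branch_unique[OF K' inverse_branch_shift[OF K, of m 0] V(2) _ that] eq m by simp
  with m show ?thesis by (rule that)
qed

end

section \<open>Large orbits lie in the Julia set\<close>

text \<open>
  A positive lower bound for the spherical distance between the disc of radius \<open>r\<close> and the exterior
  of the disc of radius \<open>r + 1\<close>.
\<close>

definition spherical_gap :: "real \<Rightarrow> real" where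
  "spherical_gap r = 2 * arcsin (1 / ((2 + r) * sqrt (1 + r\<^sup>2)))"

lemma spherical_gap_pos: "r \<ge> 0 \<Longrightarrow> spherical_gap r > 0"
proof -
  assume r: "r \<ge> 0"
  have "1 \<le> (2 + r) * sqrt (1 + r\<^sup>2)"
    using mult_mono[of 1 "2 + r" 1 "sqrt (1 + r\<^sup>2)"] r by simp
  then have "arcsin 0 < arcsin (1 / ((2 + r) * sqrt (1 + r\<^sup>2)))"
    using r by (intro arcsin_less_arcsin) (auto simp: divide_simps add_pos_nonneg)
  then show ?thesis by (simp add: spherical_gap_def)
qed

lemma spherical_dist_ge_gap:
  assumes z: "cmod z \<le> r" and w: "cmod w \<ge> r + 1"
  shows "spherical_dist z w \<ge> spherical_gap r"
proof -
  have r: "r \<ge> 0" using z norm_ge_zero[of z] by linarith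
  define sz where "sz = sqrt (1 + (cmod z)\<^sup>2)"
  define sw where "sw = sqrt (1 + (cmod w)\<^sup>2)"
  have s: "sz > 0" "sw > 0" by (auto simp: sz_def sw_def add_pos_nonneg)
  have le1: "cmod (z - w) \<le> sz * sw"
  proof -
    have "(cmod z + cmod w)\<^sup>2 \<le> (1 + (cmod z)\<^sup>2) * (1 + (cmod w)\<^sup>2)"
      using zero_le_power2[of "1 - cmod z * cmod w"] by (simp add: power2_eq_square algebra_simps)
    then have "sqrt ((cmod z + cmod w)\<^sup>2) \<le> sz * sw"
      unfolding sz_def sw_def real_sqrt_mult[symmetric] by (rule real_sqrt_le_mono)
    then show ?thesis using norm_triangle_ineq4[of z w] by simp
  qed
  have "sz \<le> sqrt (1 + r\<^sup>2)" unfolding sz_def using z by (intro real_sqrt_le_mono add_left_mono power_mono) auto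
  moreover have "sw \<le> 1 + cmod w"
    unfolding sw_def by (rule real_le_lsqrt) (auto simp: power2_eq_square algebra_simps)
  moreover have "(1 + cmod w) \<le> (2 + r) * cmod (z - w)"
  proof -
    have "cmod w - r \<le> cmod (z - w)" using norm_triangle_ineq3[of w z] z by (simp add: norm_minus_commute)
    then have "(2 + r) * (cmod w - r) \<le> (2 + r) * cmod (z - w)" using r by (intro mult_left_mono) auto
    moreover have "1 + cmod w \<le> (2 + r) * (cmod w - r)"
      using mult_nonneg_nonneg[of "1 + r" "cmod w - r - 1"] r w by (simp add: algebra_simps)
    ultimately show ?thesis by linarith
  qed
  ultimately have "sz * sw \<le> sqrt (1 + r\<^sup>2) * ((2 + r) * cmod (z - w))"
    using s by (intro mult_mono) auto
  then have "1 / ((2 + r) * sqrt (1 + r\<^sup>2)) \<le> cmod (z - w) / (sz * sw)"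
    using s r by (simp add: divide_simps add_pos_nonneg mult.commute mult.left_commute)
  then have "arcsin (1 / ((2 + r) * sqrt (1 + r\<^sup>2))) \<le> arcsin (cmod (z - w) / (sz * sw))"
  proof (intro arcsin_le_arcsin)
    have "0 \<le> 1 / ((2 + r) * sqrt (1 + r\<^sup>2))" using r by simp
    then show "- 1 \<le> 1 / ((2 + r) * sqrt (1 + r\<^sup>2))" by linarith
    show "cmod (z - w) / (sz * sw) \<le> 1" using le1 s by simp
  qed
  then show ?thesis unfolding spherical_dist_def spherical_gap_def sz_def sw_def by simp
qed

context sing_inv_in_disc
begin

text \<open>
  An orbit of \<open>f\<close> in logarithmic coordinates, together with the branches along which it can be
  pulled back.
\<close>

definition log_orbit :: "(nat \<Rightarrow> complex) \<Rightarrow> bool" where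
  "log_orbit \<eta> \<longleftrightarrow> (\<forall>n. \<exists>K. inverse_branch K \<and> \<eta> (Suc n) \<in> H \<and> K (\<eta> (Suc n)) = \<eta> n)"

lemma log_orbit_iterate: "log_orbit \<eta> \<Longrightarrow> (f ^^ n) (exp (\<eta> 0)) = exp (\<eta> n)"
proof (induction n)
  case (Suc n)
  then show ?case unfolding log_orbit_def inverse_branch_def by (simp) metis
qed simp

lemma log_orbit_tail: "log_orbit \<eta> \<Longrightarrow> log_orbit (\<eta> \<circ> Suc)"
  by (simp add: log_orbit_def)

lemma log_orbit_pull_back:
  assumes L: "L > ln R0" and contr: "\<And>K q q'. inverse_branch K \<Longrightarrow> L \<le> Re q \<Longrightarrow> L \<le> Re q' \<Longrightarrow> cmod (K q - K q') \<le> 1/2 * cmod (q - q')"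
  shows "log_orbit \<eta> \<Longrightarrow> (\<And>n. L + 4 \<le> Re (\<eta> n)) \<Longrightarrow> cmod (v - \<eta> n) \<le> 4 \<Longrightarrow>
    \<exists>v0. cmod (v0 - \<eta> 0) \<le> (1/2) ^ n * 4 \<and> (f ^^ n) (exp v0) = exp v"
proof (induction n arbitrary: \<eta>)
  case (Suc n)
  have "\<exists>v0. cmod (v0 - (\<eta> \<circ> Suc) 0) \<le> (1/2) ^ n * 4 \<and> (f ^^ n) (exp v0) = exp v"
    by (rule Suc.IH[OF log_orbit_tail[OF Suc.prems(1)]]) (use Suc.prems in auto)
  then obtain v1 where v1: "cmod (v1 - \<eta> 1) \<le> (1/2) ^ n * 4" "(f ^^ n) (exp v1) = exp v" by auto
  obtain K where K: "inverse_branch K" "K (\<eta> 1) = \<eta> 0" using Suc.prems(1) unfolding log_orbit_def by auto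
  have "(1/2::real) ^ n * 4 \<le> 4" by (simp add: power_le_one)
  then have "cmod (v1 - \<eta> 1) \<le> 4" using v1(1) by linarith
  then have v1L: "L \<le> Re v1" using abs_Re_le_cmod[of "v1 - \<eta> 1"] Suc.prems(2)[of 1] by simp
  then have v1H: "v1 \<in> H" using L by (simp add: H_def)
  have "cmod (K v1 - K (\<eta> 1)) \<le> 1/2 * cmod (v1 - \<eta> 1)"
    by (rule contr[OF K(1) v1L]) (use Suc.prems(2)[of 1] in simp)
  then have "cmod (K v1 - \<eta> 0) \<le> (1/2) ^ Suc n * 4" using v1(1) K(2) by simp
  moreover have "(f ^^ Suc n) (exp (K v1)) = exp v"
    using K(1) v1H v1(2) by (simp add: inverse_branch_def funpow_swap1)
  ultimately show ?case by blast
qed auto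

text \<open>
  For every \<open>n\<close> there is a point \<open>v\<close> within distance 4 of \<open>\<eta> n\<close> with \<open>\<bar>f (exp v)\<bar> \<le> R0\<close>. Pulled back to
  time 0 it comes as close to \<open>\<eta> 0\<close> as desired, while the images at time \<open>n + 1\<close> remain a definite
  spherical distance apart.
\<close>

lemma exp_log_orbit_in_julia_set:
  assumes L: "L > ln R0" "exp L \<ge> R0 + 1"
    and contr: "\<And>K q q'. inverse_branch K \<Longrightarrow> L \<le> Re q \<Longrightarrow> L \<le> Re q' \<Longrightarrow> cmod (K q - K q') \<le> 1/2 * cmod (q - q')"
    and \<eta>: "log_orbit \<eta>" "\<And>n. L + 4 \<le> Re (\<eta> n)"
  shows "exp (\<eta> 0) \<in> julia_set f"
proof -
  have False if U: "open U" "exp (\<eta> 0) \<in> U" and eqc: "spherically_equicontinuous_on U (range (\<lambda>n. f ^^ n))" for U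
  proof -
    obtain d where d: "d > 0" "\<And>w h. w \<in> U \<Longrightarrow> dist w (exp (\<eta> 0)) < d \<Longrightarrow> h \<in> range (\<lambda>n. f ^^ n) \<Longrightarrow>
        spherical_dist (h w) (h (exp (\<eta> 0))) < spherical_gap R0"
      using eqc U(2) spherical_gap_pos[of R0] R0_pos unfolding spherically_equicontinuous_on_def by fastforce
    obtain d' where d': "d' > 0" "ball (exp (\<eta> 0)) d' \<subseteq> U" using U open_contains_ball by blast
    have "isCont exp (\<eta> 0)" by (rule isCont_exp)
    then obtain e where e: "e > 0" "\<And>v. dist v (\<eta> 0) < e \<Longrightarrow> dist (exp v) (exp (\<eta> 0)) < min d d'"
      unfolding continuous_at_eps_delta using d(1) d'(1) by (metis min_less_iff_conj)
    obtain n where n: "(1/2::real) ^ n < e / 4" using real_arch_pow_inv[of "e/4" "1/2"] e(1) by auto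
    obtain v where v: "cmod (v - \<eta> n) < 4" "cmod (f (exp v)) \<le> R0" by (rule vertical_segment_meets_small_values)
    obtain v0 where v0: "cmod (v0 - \<eta> 0) \<le> (1/2) ^ n * 4" "(f ^^ n) (exp v0) = exp v"
      using log_orbit_pull_back[OF L(1) contr \<eta> less_imp_le[OF v(1)]] by blast
    have "dist v0 (\<eta> 0) < e" using v0(1) n by (simp add: dist_norm)
    from e(2)[OF this] have near: "dist (exp v0) (exp (\<eta> 0)) < d" "exp v0 \<in> U" using d'(2) by (auto simp: dist_commute)
    have "spherical_dist ((f ^^ Suc n) (exp v0)) ((f ^^ Suc n) (exp (\<eta> 0))) < spherical_gap R0"
      by (rule d(2)[OF near(2,1)]) blast
    moreover have "spherical_gap R0 \<le> spherical_dist ((f ^^ Suc n) (exp v0)) ((f ^^ Suc n) (exp (\<eta> 0)))"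
    proof (rule spherical_dist_ge_gap)
      show "cmod ((f ^^ Suc n) (exp v0)) \<le> R0" using v0(2) v(2) by simp
      have "R0 + 1 \<le> exp (Re (\<eta> (Suc n)))"
        by (rule order_trans[OF L(2)]) (use \<eta>(2)[of "Suc n"] in simp)
      then show "R0 + 1 \<le> cmod ((f ^^ Suc n) (exp (\<eta> 0)))"
        unfolding log_orbit_iterate[OF \<eta>(1)] by simp
    qed
    ultimately show False by simp
  qed
  then show ?thesis unfolding julia_set_def by blast
qed

end

section \<open>Shadowing orbits of an affine perturbation\<close>

text \<open>
  \<open>\<tau>\<close> is the map \<open>w \<mapsto> (w - b) / a\<close> in logarithmic coordinates.
\<close>

lemma affine_log_perturbation:
  fixes a b :: complex
  assumes a: "a \<noteq> 0"
  obtains \<tau> :: "complex \<Rightarrow> complex" and c L :: real where "c > 0"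
    "\<And>\<zeta>. L \<le> Re \<zeta> \<Longrightarrow> exp (\<tau> \<zeta>) = (exp \<zeta> - b) / a"
    "\<And>\<zeta>. L \<le> Re \<zeta> \<Longrightarrow> cmod (\<tau> \<zeta> - \<zeta>) \<le> c"
    "\<And>\<zeta> \<zeta>'. L \<le> Re \<zeta> \<Longrightarrow> L \<le> Re \<zeta>' \<Longrightarrow> cmod (\<tau> \<zeta> - \<tau> \<zeta>') \<le> 2 * cmod (\<zeta> - \<zeta>')"
    "\<And>\<zeta> m. \<tau> (\<zeta> + 2 * of_int m * of_real pi * \<i>) = \<tau> \<zeta> + 2 * of_int m * of_real pi * \<i>"
proof -
  define L where "L = ln (4 * cmod b + 1)"
  define \<tau> where "\<tau> \<zeta> = \<zeta> + Ln (1 - b * exp (-\<zeta>)) - Ln a" for \<zeta>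
  have small: "cmod (b * exp (-\<zeta>)) \<le> 1/4" if "L \<le> Re \<zeta>" for \<zeta>
  proof -
    have "4 * cmod b \<le> exp L" by (simp add: L_def add_nonneg_pos)
    also have "\<dots> \<le> exp (Re \<zeta>)" using that by simp
    finally have "4 * cmod b * exp (- Re \<zeta>) \<le> exp (Re \<zeta>) * exp (- Re \<zeta>)" by (rule mult_right_mono) simp
    then show ?thesis by (simp add: norm_mult exp_minus norm_inverse mult_ac)
  qed
  have ne: "1 - b * exp (-\<zeta>) \<noteq> 0" "1 - b * exp (-\<zeta>) \<notin> \<real>\<^sub>\<le>\<^sub>0" if "L \<le> Re \<zeta>" for \<zeta>
  proof -
    have "Re (b * exp (-\<zeta>)) \<le> 1/4" using small[OF that] abs_Re_le_cmod[of "b * exp (-\<zeta>)"] by linarith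
    then show "1 - b * exp (-\<zeta>) \<notin> \<real>\<^sub>\<le>\<^sub>0" by (auto simp: complex_nonpos_Reals_iff)
    then show "1 - b * exp (-\<zeta>) \<noteq> 0" by auto
  qed
  show ?thesis
  proof (rule that[of "1 + cmod (Ln a)" L \<tau>])
    show "1 + cmod (Ln a) > 0" by (simp add: add_pos_nonneg)
    show "exp (\<tau> \<zeta>) = (exp \<zeta> - b) / a" if "L \<le> Re \<zeta>" for \<zeta>
      using ne[OF that] a by (simp add: \<tau>_def exp_add exp_diff exp_minus field_simps)
    show "cmod (\<tau> \<zeta> - \<zeta>) \<le> 1 + cmod (Ln a)" if "L \<le> Re \<zeta>" for \<zeta>
    proof -
      have "cmod (Ln (1 + (- b * exp (-\<zeta>)))) \<le> 2 * cmod (- b * exp (-\<zeta>))"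
        by (rule norm_Ln_le) (use small[OF that] in simp)
      then have "cmod (Ln (1 - b * exp (-\<zeta>))) \<le> 1" using small[OF that] by simp
      then show ?thesis using norm_triangle_ineq4[of "Ln (1 - b * exp (-\<zeta>))" "Ln a"] by (simp add: \<tau>_def)
    qed
    show "cmod (\<tau> \<zeta> - \<tau> \<zeta>') \<le> 2 * cmod (\<zeta> - \<zeta>')" if "L \<le> Re \<zeta>" "L \<le> Re \<zeta>'" for \<zeta> \<zeta>'
    proof (rule field_differentiable_bound[of "{z. L \<le> Re z}" \<tau> "\<lambda>z. 1 + b * exp (-z) / (1 - b * exp (-z))"])
      show "convex {z. L \<le> Re z}" by (rule convex_halfspace_Re_ge)
      show "(\<tau> has_field_derivative 1 + b * exp (-z) / (1 - b * exp (-z))) (at z within {z. L \<le> Re z})"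
        if "z \<in> {z. L \<le> Re z}" for z
        unfolding \<tau>_def using ne[of z] that
        by (rule_tac has_field_derivative_at_within) (auto intro!: derivative_eq_intros simp: field_simps)
      show "cmod (1 + b * exp (-z) / (1 - b * exp (-z))) \<le> 2" if "z \<in> {z. L \<le> Re z}" for z
      proof -
        have s: "cmod (b * exp (-z)) \<le> 1/4" using small that by simp
        then have "3/4 \<le> cmod (1 - b * exp (-z))" using norm_triangle_ineq2[of 1 "b * exp (-z)"] by simp
        then have "cmod (b * exp (-z)) / cmod (1 - b * exp (-z)) \<le> (1/4) / (3/4)" using s by (intro frac_le) auto
        also have "(1/4) / (3/4) \<le> (1::real)" by simp
        finally have "cmod (b * exp (-z) / (1 - b * exp (-z))) \<le> 1" by (simp only: norm_divide)
        then show ?thesis using norm_triangle_ineq[of 1 "b * exp (-z) / (1 - b * exp (-z))"] by simp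
      qed
    qed (use that in auto)
    show "\<tau> (\<zeta> + 2 * of_int m * of_real pi * \<i>) = \<tau> \<zeta> + 2 * of_int m * of_real pi * \<i>" for \<zeta> m
    proof -
      have "exp (- (\<zeta> + 2 * of_int m * of_real pi * \<i>)) = exp (- \<zeta>)"
        unfolding exp_eq by (rule exI[of _ "- m"]) simp
      then show ?thesis by (simp add: \<tau>_def)
    qed
  qed
qed

context sing_inv_in_disc
begin

text \<open>
  \<open>\<eta>\<close> is an orbit of \<open>f\<close> and \<open>\<zeta>\<close> an orbit of \<open>a f + b\<close>, both in logarithmic coordinates, which use the
  same inverse branches of \<open>f\<close> and remain close to each other.
\<close>

definition shadows :: "(complex \<Rightarrow> complex) \<Rightarrow> real \<Rightarrow> (nat \<Rightarrow> complex) \<Rightarrow> (nat \<Rightarrow> complex) \<Rightarrow> bool" where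
  "shadows \<tau> L \<zeta> \<eta> \<longleftrightarrow> (\<forall>n. L \<le> Re (\<zeta> n) \<and> cmod (\<eta> n - \<zeta> n) \<le> 1/8 \<and>
      (\<exists>K. inverse_branch K \<and> K (\<tau> (\<zeta> (Suc n))) = \<zeta> n \<and> K (\<eta> (Suc n)) = \<eta> n))"

lemma shadows_tail: "shadows \<tau> L \<zeta> \<eta> \<Longrightarrow> shadows \<tau> L (\<zeta> \<circ> Suc) (\<eta> \<circ> Suc)"
  by (simp add: shadows_def)

text \<open>
  Replacing the initial logarithms by others only changes the first branch. This freedom allows two
  pairs of orbits to be aligned with each other.
\<close>

lemma shadows_shift:
  assumes "shadows \<tau> L \<zeta> \<eta>"
  shows "shadows \<tau> L (\<zeta>(0 := \<zeta> 0 + 2 * of_int m * of_real pi * \<i>)) (\<eta>(0 := \<eta> 0 + 2 * of_int m * of_real pi * \<i>))"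
  unfolding shadows_def
proof (intro allI conjI)
  fix n
  show "L \<le> Re ((\<zeta>(0 := \<zeta> 0 + 2 * of_int m * of_real pi * \<i>)) n)"
    and "cmod ((\<eta>(0 := \<eta> 0 + 2 * of_int m * of_real pi * \<i>)) n - (\<zeta>(0 := \<zeta> 0 + 2 * of_int m * of_real pi * \<i>)) n) \<le> 1/8"
    using assms by (auto simp: shadows_def)
  obtain K where K: "inverse_branch K" "K (\<tau> (\<zeta> (Suc n))) = \<zeta> n" "K (\<eta> (Suc n)) = \<eta> n"
    using assms unfolding shadows_def by blast
  show "\<exists>K. inverse_branch K \<and>
      K (\<tau> ((\<zeta>(0 := \<zeta> 0 + 2 * of_int m * of_real pi * \<i>)) (Suc n))) = (\<zeta>(0 := \<zeta> 0 + 2 * of_int m * of_real pi * \<i>)) n \<and>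
      K ((\<eta>(0 := \<eta> 0 + 2 * of_int m * of_real pi * \<i>)) (Suc n)) = (\<eta>(0 := \<eta> 0 + 2 * of_int m * of_real pi * \<i>)) n"
  proof (cases n)
    case 0
    then show ?thesis using inverse_branch_shift[OF K(1), of 0 m] K(2,3)
      by (intro exI[of _ "\<lambda>V. K (V + 2 * of_int 0 * of_real pi * \<i>) + 2 * of_int m * of_real pi * \<i>"]) simp
  qed (use K in auto)
qed

text \<open>
  \<open>G k n\<close> is the point at time \<open>n\<close> obtained by pulling \<open>\<zeta> (n + k)\<close> back \<open>k\<close> times along the branches of
  \<open>f\<close>. It remains close to \<open>\<zeta> n\<close> because the contraction outweighs the perturbation \<open>c\<close>, and it
  converges geometrically as \<open>k\<close> grows.
\<close>

lemma shadow_exists: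
  assumes L1: "L1 > ln R0" and \<kappa>: "0 < \<kappa>" "\<kappa> \<le> 1/2" "\<kappa> * (c + 1) \<le> 1/8" and c: "c > 0"
    and contr: "\<And>K q q'. inverse_branch K \<Longrightarrow> L1 \<le> Re q \<Longrightarrow> L1 \<le> Re q' \<Longrightarrow> cmod (K q - K q') \<le> \<kappa> * cmod (q - q')"
    and L: "L1 + c + 1 \<le> L"
    and \<tau>: "\<And>\<zeta>. L \<le> Re \<zeta> \<Longrightarrow> cmod (\<tau> \<zeta> - \<zeta>) \<le> c"
    and \<zeta>: "\<And>n. L \<le> Re (\<zeta> n)" "\<And>n. f (exp (\<zeta> n)) = exp (\<tau> (\<zeta> (Suc n)))"
  obtains \<eta> where "shadows \<tau> L \<zeta> \<eta>"
proof -
  have \<tau>L: "L1 \<le> Re (\<tau> (\<zeta> n))" for n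
    using \<tau>[OF \<zeta>(1)[of n]] \<zeta>(1)[of n] L abs_Re_le_cmod[of "\<tau> (\<zeta> n) - \<zeta> n"] by simp
  have "\<exists>K. inverse_branch K \<and> K (\<tau> (\<zeta> (Suc n))) = \<zeta> n" for n
    by (rule inverse_branch_exists[OF _ \<zeta>(2)[of n]]) (use \<tau>L[of "Suc n"] L1 in \<open>auto simp: H_def\<close>)
  then obtain K where K: "\<And>n. inverse_branch (K n)" "\<And>n. K n (\<tau> (\<zeta> (Suc n))) = \<zeta> n" by metis
  define G where "G k = rec_nat \<zeta> (\<lambda>_ g n. K n (g (Suc n))) k" for k
  have G: "G 0 = \<zeta>" "\<And>k n. G (Suc k) n = K n (G k (Suc n))" by (simp_all add: G_def)
  have close: "cmod (G k n - \<zeta> n) \<le> 1/8" for k n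
  proof (induction k arbitrary: n)
    case (Suc k)
    let ?g = "G k (Suc n)" and ?z = "\<zeta> (Suc n)"
    have gL: "L1 \<le> Re ?g" using Suc[of "Suc n"] \<zeta>(1)[of "Suc n"] L c abs_Re_le_cmod[of "?g - ?z"] by simp
    have "cmod (K n ?g - K n (\<tau> ?z)) \<le> \<kappa> * cmod (?g - \<tau> ?z)" by (rule contr[OF K(1) gL \<tau>L])
    also have "\<dots> \<le> \<kappa> * (1/8 + c)"
    proof (rule mult_left_mono)
      show "cmod (?g - \<tau> ?z) \<le> 1/8 + c"
        using norm_triangle_ineq4[of "?g - ?z" "\<tau> ?z - ?z"] Suc[of "Suc n"] \<tau>[OF \<zeta>(1)[of "Suc n"]] by simp
    qed (use \<kappa> in simp)
    also have "\<dots> \<le> 1/8" using \<kappa> by (simp add: algebra_simps)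
    finally show ?case using K(2)[of n] by (simp add: G)
  qed (simp add: G)
  have GL: "L1 \<le> Re (G k n)" for k n
    using close[of k n] \<zeta>(1)[of n] L c abs_Re_le_cmod[of "G k n - \<zeta> n"] by simp
  have step: "cmod (G (Suc k) n - G k n) \<le> (1/2) ^ k * (1/8)" for k n
  proof (induction k arbitrary: n)
    case 0
    then show ?case using close[of "Suc 0" n] by (simp add: G(1))
  next
    case (Suc k)
    have "cmod (G (Suc (Suc k)) n - G (Suc k) n) \<le> \<kappa> * cmod (G (Suc k) (Suc n) - G k (Suc n))"
      unfolding G(2)[of "Suc k" n] G(2)[of k n] by (rule contr[OF K(1) GL GL])
    also have "\<dots> \<le> (1/2) * ((1/2) ^ k * (1/8))" by (rule mult_mono) (use \<kappa> Suc in auto)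
    finally show ?case by simp
  qed
  have "convergent (\<lambda>k. G k n)" for n
  proof -
    have "summable (\<lambda>k. G (Suc k) n - G k n)"
      by (rule summable_comparison_test'[OF summable_mult2[OF summable_geometric[of "1/2::real"], of "1/8"], of 0])
         (use step in auto)
    then have "(\<lambda>k. \<Sum>j<k. G (Suc j) n - G j n) \<longlonglongrightarrow> (\<Sum>j. G (Suc j) n - G j n)" by (rule summable_LIMSEQ)
    then have "(\<lambda>k. G k n - G 0 n) \<longlonglongrightarrow> (\<Sum>j. G (Suc j) n - G j n)"
      by (simp only: sum_lessThan_telescope[of "\<lambda>k. G k n"])
    from tendsto_add[OF this tendsto_const[of "G 0 n"]] show ?thesis by (auto simp: convergent_def)
  qed
  then obtain \<eta> where \<eta>: "\<And>n. (\<lambda>k. G k n) \<longlonglongrightarrow> \<eta> n" unfolding convergent_def by metis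
  have \<eta>close: "cmod (\<eta> n - \<zeta> n) \<le> 1/8" for n
    by (rule tendsto_upperbound[OF tendsto_norm[OF tendsto_diff[OF \<eta> tendsto_const]]])
       (use close in auto)
  have "K n (\<eta> (Suc n)) = \<eta> n" for n
  proof -
    have "L1 \<le> Re (\<eta> (Suc n))"
      using \<eta>close[of "Suc n"] \<zeta>(1)[of "Suc n"] L c abs_Re_le_cmod[of "\<eta> (Suc n) - \<zeta> (Suc n)"] by simp
    then have "\<eta> (Suc n) \<in> H" using L1 by (simp add: H_def)
    moreover have "continuous_on H (K n)"
      using K(1) by (auto simp: inverse_branch_def intro: holomorphic_on_imp_continuous_on)
    ultimately have "isCont (K n) (\<eta> (Suc n))" using continuous_on_eq_continuous_at[OF open_H] by blast
    then have "(\<lambda>k. K n (G k (Suc n))) \<longlonglongrightarrow> K n (\<eta> (Suc n))" by (rule isCont_tendsto_compose[OF _ \<eta>])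
    moreover have "(\<lambda>k. K n (G k (Suc n))) \<longlonglongrightarrow> \<eta> n"
      unfolding G(2)[symmetric] using \<eta>[of n] by (rule LIMSEQ_Suc)
    ultimately show ?thesis by (rule LIMSEQ_unique)
  qed
  then have "shadows \<tau> L \<zeta> \<eta>" unfolding shadows_def using \<zeta>(1) \<eta>close K by blast
  then show ?thesis by (rule that)
qed

text \<open>
  Let \<open>A\<close> and \<open>B\<close> be the distances between the initial points of the two orbits of \<open>f\<close> and of the two
  orbits of \<open>a f + b\<close>, and let \<open>A1\<close> and \<open>B1\<close> be the corresponding distances one step later.
  
  If the first step of both orbits of \<open>f\<close> uses the same branch with arguments at distance less than
  \<open>\<rho>\<close>, then \<open>B / A \<le> 6 B1 / A1\<close> by bounded distortion, and \<open>A \<le> \<kappa> A1\<close>. So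
  \<open>B / A powr (1 - s) \<le> 6 \<kappa> powr s * (B1 / A1 powr (1 - s))\<close>, and the bound is inherited from the next
  step. Otherwise the initial points are separated: the \<open>\<rho>\<close>-disc around \<open>\<eta> 1\<close> has an image that does
  not contain \<open>\<eta>' 0\<close>. As \<open>\<rho>\<close> is large compared with the perturbation \<open>c\<close>, the distances of \<open>\<zeta> 0\<close> to
  \<open>\<eta> 0\<close> and of \<open>\<zeta>' 0\<close> to \<open>\<eta>' 0\<close> are then at most \<open>A\<close>, and \<open>B \<le> 3 A\<close>.
  
  Orbits that never separate are covered by an error term \<open>(1/2) ^ n\<close> in an induction on the number
  \<open>n\<close> of steps, which disappears in the limit.
\<close>

lemma shadow_inverse_holder:
  fixes s :: real
  assumes L1: "L1 > ln R0" and \<kappa>: "0 < \<kappa>" "\<kappa> \<le> 1/6" "6 * \<kappa> powr s \<le> 1" and s: "0 < s" "s < 1" and c: "c > 0"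
    and \<rho>: "\<rho> = 3 * c + 3"
    and deriv_le: "\<And>K p. inverse_branch K \<Longrightarrow> L1 \<le> Re p \<Longrightarrow> cmod (deriv K p) \<le> \<kappa>"
    and contr: "\<And>K q q'. inverse_branch K \<Longrightarrow> L1 \<le> Re q \<Longrightarrow> L1 \<le> Re q' \<Longrightarrow> cmod (K q - K q') \<le> \<kappa> * cmod (q - q')"
    and lin: "\<And>K p q q'. inverse_branch K \<Longrightarrow> L1 \<le> Re p \<Longrightarrow> cmod (q - p) \<le> \<rho> + c + 1 \<Longrightarrow> cmod (q' - p) \<le> \<rho> + c + 1 \<Longrightarrow>
        cmod (K q - K q' - deriv K p * (q - q')) \<le> cmod (deriv K p) / 2 * cmod (q - q')"
    and L: "L1 + \<rho> + 1 \<le> L"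
    and \<tau>: "\<And>\<zeta>. L \<le> Re \<zeta> \<Longrightarrow> cmod (\<tau> \<zeta> - \<zeta>) \<le> c"
    and \<tau>_lip: "\<And>\<zeta> \<zeta>'. L \<le> Re \<zeta> \<Longrightarrow> L \<le> Re \<zeta>' \<Longrightarrow> cmod (\<tau> \<zeta> - \<tau> \<zeta>') \<le> 2 * cmod (\<zeta> - \<zeta>')"
    and \<tau>_shift: "\<And>\<zeta> m. \<tau> (\<zeta> + 2 * of_int m * of_real pi * \<i>) = \<tau> \<zeta> + 2 * of_int m * of_real pi * \<i>"
    and sh: "shadows \<tau> L \<zeta> \<eta>" "shadows \<tau> L \<zeta>' \<eta>'" and near: "cmod (\<eta> 0 - \<eta>' 0) < \<rho>"
  shows "cmod (\<zeta> 0 - \<zeta>' 0) \<le> 3 * \<rho> powr s * cmod (\<eta> 0 - \<eta>' 0) powr (1 - s)"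
proof -
  have \<rho>0: "\<rho> > 0" using c \<rho> by simp
  have upper: "cmod (K q - K q') \<le> 3/2 * cmod (deriv K p) * cmod (q - q')"
    and lower: "cmod (deriv K p) / 2 * cmod (q - q') \<le> cmod (K q - K q')"
    if "inverse_branch K" "L1 \<le> Re p" "cmod (q - p) \<le> \<rho> + c + 1" "cmod (q' - p) \<le> \<rho> + c + 1" for K p q q'
  proof -
    let ?d = "deriv K p * (q - q')"
    have "cmod (K q - K q' - ?d) \<le> cmod (deriv K p) / 2 * cmod (q - q')" by (rule lin[OF that])
    moreover have "cmod ?d = cmod (deriv K p) * cmod (q - q')" by (rule norm_mult)
    ultimately show "cmod (K q - K q') \<le> 3/2 * cmod (deriv K p) * cmod (q - q')"
      and "cmod (deriv K p) / 2 * cmod (q - q') \<le> cmod (K q - K q')"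
      using norm_triangle_ineq2[of "K q - K q'" ?d] norm_triangle_ineq2[of ?d "K q - K q'"]
      by (simp_all add: norm_minus_commute algebra_simps)
  qed
  \<comment> \<open>A quarter theorem for the nearly affine branch.\<close>
  have cover: "\<exists>v. cmod (v - p) < \<rho> \<and> w = K v"
    if K: "inverse_branch K" and p: "L1 + \<rho> \<le> Re p" and w: "cmod (w - K p) < cmod (deriv K p) / 2 * \<rho>" for K p w
  proof -
    have cb: "cball p \<rho> \<subseteq> H"
    proof
      fix v assume "v \<in> cball p \<rho>"
      then have "L1 \<le> Re v" using p abs_Re_le_cmod[of "p - v"] by (simp add: dist_norm)
      then show "v \<in> H" using L1 by (simp add: H_def)
    qed
    then have hol: "K holomorphic_on cball p \<rho>" using K by (auto simp: inverse_branch_def intro: holomorphic_on_subset)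
    have "ball (K p) (cmod (deriv K p) / 2 * \<rho>) \<subseteq> K ` ball p \<rho>"
    proof (rule ball_subset_open_map_image)
      show "continuous_on (closure (ball p \<rho>)) K"
        using holomorphic_on_imp_continuous_on[OF hol] \<rho>0 by simp
      have "open (K ` ball p \<rho>)"
        by (rule open_mapping_thm3[OF holomorphic_on_subset[OF hol ball_subset_cball] open_ball
              inj_on_subset[OF inverse_branch_inj[OF K] subset_trans[OF ball_subset_cball cb]]])
      then show "open (K ` interior (ball p \<rho>))" by (simp add: interior_open)
      fix z assume "z \<in> frontier (ball p \<rho>)"
      then have z: "cmod (z - p) = \<rho>" using \<rho>0 by (simp add: dist_norm norm_minus_commute)
      have "cmod (deriv K p) / 2 * cmod (z - p) \<le> cmod (K z - K p)"
        by (rule lower[OF K]) (use p \<rho>0 z c in auto)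
      then show "cmod (deriv K p) / 2 * \<rho> \<le> cmod (K z - K p)" by (simp add: z)
    qed (use \<rho>0 le_less_trans[OF norm_ge_zero w] in auto)
    moreover have "w \<in> ball (K p) (cmod (deriv K p) / 2 * \<rho>)" using w by (simp add: dist_norm norm_minus_commute)
    ultimately show ?thesis by (force simp: dist_norm norm_minus_commute)
  qed
  have \<eta>_close: "cmod (\<eta> n - \<zeta> n) \<le> 1/8" "L \<le> Re (\<zeta> n)" "L1 + \<rho> \<le> Re (\<eta> n)" "L1 \<le> Re (\<eta> n)" "\<eta> n \<in> H"
      "cmod (\<tau> (\<zeta> n) - \<eta> n) \<le> c + 1/8" if "shadows \<tau> L \<zeta> \<eta>" for \<zeta> \<eta> n
  proof -
    show 1: "cmod (\<eta> n - \<zeta> n) \<le> 1/8" "L \<le> Re (\<zeta> n)" using that by (auto simp: shadows_def)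
    show "L1 + \<rho> \<le> Re (\<eta> n)" using 1 L abs_Re_le_cmod[of "\<eta> n - \<zeta> n"] by simp
    then show 2: "L1 \<le> Re (\<eta> n)" using \<rho>0 by linarith
    then show "\<eta> n \<in> H" using L1 by (simp add: H_def)
    show "cmod (\<tau> (\<zeta> n) - \<eta> n) \<le> c + 1/8"
      using norm_triangle_ineq4[of "\<tau> (\<zeta> n) - \<zeta> n" "\<eta> n - \<zeta> n"] 1 \<tau>[OF 1(2)] by simp
  qed
  have separated: "cmod (\<zeta> 0 - \<zeta>' 0) \<le> 3 * cmod (\<eta> 0 - \<eta>' 0)"
    if sh: "shadows \<tau> L \<zeta> \<eta>" and sh': "shadows \<tau> L \<zeta>' \<eta>'"
      and K: "inverse_branch K" "K (\<tau> (\<zeta> 1)) = \<zeta> 0" "K (\<eta> 1) = \<eta> 0"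
      and K': "inverse_branch K'" "K' (\<tau> (\<zeta>' 1)) = \<zeta>' 0" "K' (\<eta>' 1) = \<eta>' 0"
      and sep: "\<And>v. cmod (v - \<eta> 1) < \<rho> \<Longrightarrow> \<eta>' 0 \<noteq> K v"
    for \<zeta> \<eta> \<zeta>' \<eta>' K K'
  proof -
    have dist_le: "cmod (\<zeta> 0 - \<eta> 0) \<le> cmod (\<eta> 0 - \<eta>' 0)"
      if sh: "shadows \<tau> L \<zeta> \<eta>" and K: "inverse_branch K" "K (\<tau> (\<zeta> 1)) = \<zeta> 0" "K (\<eta> 1) = \<eta> 0"
        and sep: "\<And>v. cmod (v - \<eta> 1) < \<rho> \<Longrightarrow> \<eta>' 0 \<noteq> K v" for \<zeta> \<eta> \<eta>' K
    proof -
      have "\<not> cmod (\<eta>' 0 - K (\<eta> 1)) < cmod (deriv K (\<eta> 1)) / 2 * \<rho>"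
        using cover[OF K(1) \<eta>_close(3)[OF sh]] sep by blast
      then have "cmod (deriv K (\<eta> 1)) / 2 * \<rho> \<le> cmod (\<eta> 0 - \<eta>' 0)" using K(3) by (simp add: norm_minus_commute)
      moreover have "cmod (K (\<tau> (\<zeta> 1)) - K (\<eta> 1)) \<le> 3/2 * cmod (deriv K (\<eta> 1)) * cmod (\<tau> (\<zeta> 1) - \<eta> 1)"
        by (rule upper[OF K(1) \<eta>_close(4)[OF sh]]) (use \<eta>_close(6)[OF sh, of 1] \<rho>0 c in auto)
      moreover have "3/2 * cmod (deriv K (\<eta> 1)) * cmod (\<tau> (\<zeta> 1) - \<eta> 1) \<le> 3/2 * cmod (deriv K (\<eta> 1)) * (\<rho> / 3)"
        using \<eta>_close(6)[OF sh, of 1] \<rho> by (intro mult_left_mono) auto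
      ultimately show ?thesis using K by (simp add: algebra_simps)
    qed
    \<comment> \<open>Separation is symmetric: a common branch for one orbit is one for the other, after aligning the
      logarithms.\<close>
    have sep': "\<eta> 0 \<noteq> K' v" if v: "cmod (v - \<eta>' 1) < \<rho>" for v
    proof
      assume eq: "\<eta> 0 = K' v"
      have "L1 \<le> Re v" using v \<eta>_close(3)[OF sh', of 1] abs_Re_le_cmod[of "v - \<eta>' 1"] by simp
      then have vH: "v \<in> H" using L1 by (simp add: H_def)
      obtain m :: int where m: "\<eta> 1 = v + 2 * of_int m * of_real pi * \<i>"
        "\<And>W. W \<in> H \<Longrightarrow> K' W = K (W + 2 * of_int m * of_real pi * \<i>)"
        using inverse_branch_align[OF K(1) K'(1) \<eta>_close(5)[OF sh] vH] K(3) eq by metis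
      have "\<eta>' 0 = K (\<eta>' 1 + 2 * of_int m * of_real pi * \<i>)" using m(2)[OF \<eta>_close(5)[OF sh']] K'(3) by simp
      moreover have "cmod (\<eta>' 1 + 2 * of_int m * of_real pi * \<i> - \<eta> 1) < \<rho>"
        using v m(1) by (simp add: norm_minus_commute)
      ultimately show False using sep by blast
    qed
    have "cmod (\<zeta> 0 - \<eta> 0) \<le> cmod (\<eta> 0 - \<eta>' 0)" by (rule dist_le[of \<zeta> \<eta> K \<eta>', OF sh K sep])
    moreover have "cmod (\<zeta>' 0 - \<eta>' 0) \<le> cmod (\<eta>' 0 - \<eta> 0)" by (rule dist_le[of \<zeta>' \<eta>' K' \<eta>, OF sh' K' sep'])
    moreover have "cmod (\<zeta> 0 - \<zeta>' 0) \<le> cmod (\<zeta> 0 - \<eta> 0) + cmod (\<eta> 0 - \<eta>' 0) + cmod (\<zeta>' 0 - \<eta>' 0)"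
      using norm_triangle_ineq[of "\<zeta> 0 - \<eta> 0" "\<eta> 0 - \<eta>' 0"] norm_triangle_ineq4[of "\<zeta> 0 - \<eta>' 0" "\<zeta>' 0 - \<eta>' 0"]
      by simp
    ultimately show ?thesis by (simp add: norm_minus_commute)
  qed
  have approx: "cmod (\<zeta> 0 - \<zeta>' 0) \<le> 3 * \<rho> powr s * cmod (\<eta> 0 - \<eta>' 0) powr (1 - s) + (1/2) ^ n * (\<rho> + 1)"
    if "shadows \<tau> L \<zeta> \<eta>" "shadows \<tau> L \<zeta>' \<eta>'" "cmod (\<eta> 0 - \<eta>' 0) < \<rho>" for n \<zeta> \<eta> \<zeta>' \<eta>'
    using that
  proof (induction n arbitrary: \<zeta> \<eta> \<zeta>' \<eta>')
    case 0
    have "cmod (\<zeta> 0 - \<zeta>' 0) \<le> cmod (\<eta> 0 - \<zeta> 0) + cmod (\<eta> 0 - \<eta>' 0) + cmod (\<eta>' 0 - \<zeta>' 0)"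
      using norm_triangle_ineq4[of "\<eta> 0 - \<eta>' 0" "\<eta> 0 - \<zeta> 0"] norm_triangle_ineq[of "\<zeta> 0 - \<eta>' 0" "\<eta>' 0 - \<zeta>' 0"]
      by simp
    then have "cmod (\<zeta> 0 - \<zeta>' 0) \<le> \<rho> + 1"
      using 0 \<eta>_close(1)[OF 0(1), of 0] \<eta>_close(1)[OF 0(2), of 0] by simp
    moreover have "0 \<le> 3 * \<rho> powr s * cmod (\<eta> 0 - \<eta>' 0) powr (1 - s)" by simp
    ultimately show ?case unfolding power_0 mult_1_left by linarith
  next
    case (Suc n)
    define A where "A = cmod (\<eta> 0 - \<eta>' 0)"
    obtain K where K: "inverse_branch K" "K (\<tau> (\<zeta> 1)) = \<zeta> 0" "K (\<eta> 1) = \<eta> 0"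
      using Suc.prems(1) unfolding shadows_def by fastforce
    obtain K' where K': "inverse_branch K'" "K' (\<tau> (\<zeta>' 1)) = \<zeta>' 0" "K' (\<eta>' 1) = \<eta>' 0"
      using Suc.prems(2) unfolding shadows_def by fastforce
    show ?case
    proof (cases "\<exists>v. cmod (v - \<eta> 1) < \<rho> \<and> \<eta>' 0 = K v")
      case False
      then have "cmod (\<zeta> 0 - \<zeta>' 0) \<le> 3 * A"
        unfolding A_def by (intro separated[OF Suc.prems(1,2) K K']) auto
      \<comment> \<open>The separated case; here \<open>A < \<rho>\<close>.\<close>
      also have "A = A powr s * A powr (1 - s)" by (simp add: powr_add[symmetric] A_def)
      also have "3 * \<dots> \<le> 3 * (\<rho> powr s * A powr (1 - s))"
        using Suc.prems(3) s by (intro mult_left_mono mult_right_mono powr_mono2) (auto simp: A_def)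
      finally have "cmod (\<zeta> 0 - \<zeta>' 0) \<le> 3 * \<rho> powr s * A powr (1 - s)" by simp
      moreover have "0 \<le> (1/2) ^ Suc n * (\<rho> + 1)" using \<rho>0 by simp
      ultimately show ?thesis unfolding A_def by linarith
    next
      case True
      then obtain v where v: "cmod (v - \<eta> 1) < \<rho>" "\<eta>' 0 = K v" by blast
      have vL: "L1 \<le> Re v" using v(1) \<eta>_close(3)[OF Suc.prems(1), of 1] abs_Re_le_cmod[of "v - \<eta> 1"] by simp
      then have vH: "v \<in> H" using L1 by (simp add: H_def)
      obtain m :: int where m: "v = \<eta>' 1 + 2 * of_int m * of_real pi * \<i>"
        "\<And>W. W \<in> H \<Longrightarrow> K' W = K (W + 2 * of_int m * of_real pi * \<i>)"
        using inverse_branch_align[OF K(1) K'(1) vH \<eta>_close(5)[OF Suc.prems(2), of 1]] K'(3) v(2) by metis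
      define z where "z = \<zeta>' 1 + 2 * of_int m * of_real pi * \<i>"
      define A1 where "A1 = cmod (\<eta> 1 - v)"
      have sh1: "shadows \<tau> L (\<zeta> \<circ> Suc) (\<eta> \<circ> Suc)" by (rule shadows_tail[OF Suc.prems(1)])
      \<comment> \<open>The tail of the second orbit, realigned so that its first step uses the branch \<open>K\<close>.\<close>
      have sh2: "shadows \<tau> L ((\<zeta>' \<circ> Suc)(0 := z)) ((\<eta>' \<circ> Suc)(0 := v))"
        using shadows_shift[OF shadows_tail[OF Suc.prems(2)], of m] by (simp add: z_def m(1))
      have IH: "cmod (\<zeta> 1 - z) \<le> 3 * \<rho> powr s * A1 powr (1 - s) + (1/2) ^ n * (\<rho> + 1)"
        using Suc.IH[OF sh1 sh2] v(1) by (simp add: A1_def norm_minus_commute)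
      have zL: "L \<le> Re z" using \<eta>_close(2)[OF Suc.prems(2), of 1] by (simp add: z_def)
      have z_eq: "\<zeta>' 0 = K (\<tau> z)"
      proof -
        have "L1 \<le> Re (\<tau> (\<zeta>' 1))"
          using \<tau>[OF \<eta>_close(2)[OF Suc.prems(2), of 1]] \<eta>_close(2)[OF Suc.prems(2), of 1] L \<rho> c
            abs_Re_le_cmod[of "\<tau> (\<zeta>' 1) - \<zeta>' 1"] by simp
        then have "\<tau> (\<zeta>' 1) \<in> H" using L1 by (simp add: H_def)
        from m(2)[OF this] show ?thesis using K'(2) \<tau>_shift by (simp add: z_def)
      qed
      define D where "D = cmod (deriv K (\<eta> 1))"
      have D\<kappa>: "D \<le> \<kappa>" "0 \<le> D" unfolding D_def using deriv_le[OF K(1) \<eta>_close(4)[OF Suc.prems(1)]] by auto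
      have \<tau>z: "cmod (\<tau> z - \<eta> 1) \<le> \<rho> + c + 1"
      proof -
        have "cmod (\<tau> z - v) = cmod (\<tau> (\<zeta>' 1) - \<eta>' 1)" by (simp add: z_def m(1) \<tau>_shift)
        then show ?thesis using \<eta>_close(6)[OF Suc.prems(2), of 1] v(1) norm_triangle_ineq[of "\<tau> z - v" "v - \<eta> 1"] by simp
      qed
      have "cmod (\<zeta> 0 - \<zeta>' 0) \<le> 3/2 * D * cmod (\<tau> (\<zeta> 1) - \<tau> z)"
        unfolding K(2)[symmetric] z_eq D_def
        by (rule upper[OF K(1) \<eta>_close(4)[OF Suc.prems(1)] _ \<tau>z]) (use \<eta>_close(6)[OF Suc.prems(1), of 1] \<rho>0 in simp)
      also have "\<dots> \<le> 3/2 * D * (2 * cmod (\<zeta> 1 - z))"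
        using D\<kappa> by (intro mult_left_mono \<tau>_lip \<eta>_close(2)[OF Suc.prems(1)] zL) auto
      also have "\<dots> = 3 * D * cmod (\<zeta> 1 - z)" by simp
      also have "\<dots> \<le> 3 * D * (3 * \<rho> powr s * A1 powr (1 - s) + (1/2) ^ n * (\<rho> + 1))"
        using IH D\<kappa> by (intro mult_left_mono) auto
      also have "\<dots> = 3 * \<rho> powr s * (3 * D * A1 powr (1 - s)) + 3 * D * ((1/2) ^ n * (\<rho> + 1))"
        by (simp add: algebra_simps)
      also have "\<dots> \<le> 3 * \<rho> powr s * A powr (1 - s) + 1/2 * ((1/2) ^ n * (\<rho> + 1))"
      proof (intro add_mono mult_left_mono mult_right_mono)
        show "3 * D \<le> 1/2" using D\<kappa> \<kappa> by simp
        show "0 \<le> (1/2) ^ n * (\<rho> + 1)" using \<rho>0 by simp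
        have A_low: "D / 2 * A1 \<le> A"
          unfolding A_def A1_def D_def K(3)[symmetric] v(2)
          by (rule lower[OF K(1) \<eta>_close(4)[OF Suc.prems(1)]]) (use v(1) c \<rho>0 in auto)
        have A_up: "A \<le> \<kappa> * A1"
          unfolding A_def A1_def K(3)[symmetric] v(2) by (rule contr[OF K(1) \<eta>_close(4)[OF Suc.prems(1)] vL])
        have A0: "A \<ge> 0" "A1 \<ge> 0" by (auto simp: A_def A1_def)
        show "3 * D * A1 powr (1 - s) \<le> A powr (1 - s)"
        proof (cases "D * A1 = 0")
          case True
          then show ?thesis by auto
        next
          case False
          then have pos: "A1 > 0" "D > 0" using A0 D\<kappa> by auto
          then have Apos: "A > 0" using A_low by (metis divide_pos_pos less_le_trans mult_pos_pos zero_less_numeral)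
          have "(1/\<kappa>) * A \<le> A1" using A_up \<kappa>(1) by (simp add: field_simps)
          then have "A1 powr (-s) \<le> ((1/\<kappa>) * A) powr (-s)" using Apos \<kappa>(1) s by (intro powr_mono2') auto
          also have "\<dots> = \<kappa> powr s * A powr (-s)"
            using \<kappa>(1) Apos by (simp add: powr_mult powr_divide powr_minus_divide)
          finally have 1: "A1 powr (-s) \<le> \<kappa> powr s * A powr (-s)" .
          have "3 * D * A1 powr (1 - s) = 6 * (D / 2 * A1) * A1 powr (-s)"
            using pos by (simp add: powr_diff powr_minus_divide)
          also have "\<dots> \<le> 6 * A * (\<kappa> powr s * A powr (-s))"
            using A_low A0 1 pos by (intro mult_mono) auto
          also have "\<dots> = 6 * \<kappa> powr s * A powr (1 - s)"
            using Apos by (simp add: powr_diff powr_minus_divide)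
          also have "\<dots> \<le> 1 * A powr (1 - s)" using \<kappa>(3) by (intro mult_right_mono) auto
          finally show ?thesis by simp
        qed
      qed (use \<rho>0 in auto)
      finally show ?thesis by (simp add: A_def)
    qed
  qed
  have lim: "(\<lambda>n. 3 * \<rho> powr s * cmod (\<eta> 0 - \<eta>' 0) powr (1 - s) + (1/2) ^ n * (\<rho> + 1)) \<longlonglongrightarrow>
      3 * \<rho> powr s * cmod (\<eta> 0 - \<eta>' 0) powr (1 - s) + 0 * (\<rho> + 1)"
    by (intro tendsto_intros LIMSEQ_power_zero) simp
  show ?thesis
    using LIMSEQ_le_const[OF lim, of "cmod (\<zeta> 0 - \<zeta>' 0)"] approx[OF sh near] by auto
qed

end

section \<open>Comparison of dimensions\<close>

lemma norm_exp_minus_one_bounds: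
  fixes w :: complex
  assumes "cmod w \<le> 1/3"
  shows "cmod (exp w - 1) \<le> 2 * cmod w" and "cmod w \<le> 3 * cmod (exp w - 1)"
proof -
  have upper: "cmod (exp v - 1) \<le> 2 * cmod v" if "cmod v \<le> 1/3" for v :: complex
  proof -
    have "cmod (exp v - exp 0) \<le> 2 * cmod (v - 0)"
    proof (rule field_differentiable_bound[of "cball 0 (1/3)" exp exp])
      show "(exp has_field_derivative exp z) (at z within cball 0 (1/3))" for z :: complex
        by (rule has_field_derivative_at_within[OF DERIV_exp])
      show "cmod (exp z) \<le> 2" if "z \<in> cball 0 (1/3)" for z
      proof -
        have "Re z \<le> 1/2" using that abs_Re_le_cmod[of z] by simp
        then have "cmod (exp z) \<le> exp (1/2)" by simp
        then show ?thesis using exp_half_le2 by linarith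
      qed
    qed (use that in auto)
    then show ?thesis by simp
  qed
  have "cmod ((exp w - w) - (exp 0 - 0)) \<le> 2/3 * cmod (w - 0)"
  proof (rule field_differentiable_bound[of "cball 0 (1/3)" "\<lambda>z. exp z - z" "\<lambda>z. exp z - 1"])
    show "((\<lambda>z. exp z - z) has_field_derivative exp z - 1) (at z within cball 0 (1/3))" for z :: complex
      by (rule has_field_derivative_at_within) (auto intro!: derivative_eq_intros)
    show "cmod (exp z - 1) \<le> 2/3" if "z \<in> cball 0 (1/3)" for z
      using upper[of z] that by simp
  qed (use assms in auto)
  then have "cmod (w - (exp w - 1)) \<le> 2/3 * cmod w" by (simp add: norm_minus_commute algebra_simps)
  then show "cmod w \<le> 3 * cmod (exp w - 1)" using norm_triangle_ineq2[of w "exp w - 1"] by linarith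
  show "cmod (exp w - 1) \<le> 2 * cmod w" by (rule upper[OF assms])
qed

lemma holomorphic_locally_expanding:
  assumes f: "f holomorphic_on UNIV" and d: "deriv f x \<noteq> 0"
  obtains r where "r > 0" "\<And>y z. y \<in> ball x r \<Longrightarrow> z \<in> ball x r \<Longrightarrow> cmod (deriv f x) / 2 * cmod (y - z) \<le> cmod (f y - f z)"
proof -
  have "isCont (deriv f) x"
    using holomorphic_on_imp_continuous_on[OF holomorphic_deriv[OF f open_UNIV]] continuous_on_eq_continuous_at[OF open_UNIV] by blast
  then obtain r where r: "r > 0" "\<And>v. dist v x < r \<Longrightarrow> dist (deriv f v) (deriv f x) < cmod (deriv f x) / 2"
    using d unfolding continuous_at_eps_delta by (metis half_gt_zero zero_less_norm_iff)
  show ?thesis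
  proof (rule that[OF r(1)])
    fix y z assume yz: "y \<in> ball x r" "z \<in> ball x r"
    have "cmod ((f y - deriv f x * y) - (f z - deriv f x * z)) \<le> cmod (deriv f x) / 2 * cmod (y - z)"
    proof (rule field_differentiable_bound[of "ball x r" "\<lambda>v. f v - deriv f x * v" "\<lambda>v. deriv f v - deriv f x"])
      show "((\<lambda>v. f v - deriv f x * v) has_field_derivative deriv f v - deriv f x) (at v within ball x r)" for v
        using holomorphic_derivI[OF f open_UNIV UNIV_I, of v]
        by (rule_tac has_field_derivative_at_within) (auto intro!: derivative_eq_intros)
      show "cmod (deriv f v - deriv f x) \<le> cmod (deriv f x) / 2" if "v \<in> ball x r" for v
        using r(2)[of v] that by (simp add: dist_norm norm_minus_commute)
    qed (use yz in auto)
    moreover have "cmod (deriv f x * (y - z)) - cmod (f y - f z) \<le> cmod ((f y - deriv f x * y) - (f z - deriv f x * z))"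
      using norm_triangle_ineq2[of "deriv f x * (y - z)" "f y - f z"] by (simp add: algebra_simps norm_minus_commute)
    ultimately show "cmod (deriv f x) / 2 * cmod (y - z) \<le> cmod (f y - f z)" by (simp add: norm_mult)
  qed
qed

context sing_inv_in_disc
begin

text \<open>
  The map \<open>\<theta>\<close> sends \<open>x\<close> to the exponential of the initial point of the \<open>f\<close>-orbit that shadows the
  logarithms of \<open>g x, g (g x), \<dots>\<close>. The point \<open>x\<close> itself is skipped since it need not be large. This
  causes no loss, because \<open>g\<close> is locally expanding at \<open>x\<close> up to a constant: \<open>f x\<close> is large and hence not a
  critical value.
\<close>

lemma dim_orbits_near_infinity_le:
  fixes a b :: complex and R s :: real
  defines "g \<equiv> \<lambda>z. a * f z + b"
  assumes a: "a \<noteq> 0" and s: "0 < s" "s < 1" and R: "R > 0"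
  obtains R' where "R' > 0"
    "ennreal (1 - s) * hausdorff_dim {x. \<forall>n\<ge>1. R' \<le> cmod ((g ^^ n) x)} \<le> hausdorff_dim (julia_outside R f)"
proof -
  obtain \<tau> :: "complex \<Rightarrow> complex" and c L2 :: real where c: "c > 0"
    and \<tau>_exp: "\<And>\<zeta>. L2 \<le> Re \<zeta> \<Longrightarrow> exp (\<tau> \<zeta>) = (exp \<zeta> - b) / a"
    and \<tau>_near: "\<And>\<zeta>. L2 \<le> Re \<zeta> \<Longrightarrow> cmod (\<tau> \<zeta> - \<zeta>) \<le> c"
    and \<tau>_lip: "\<And>\<zeta> \<zeta>'. L2 \<le> Re \<zeta> \<Longrightarrow> L2 \<le> Re \<zeta>' \<Longrightarrow> cmod (\<tau> \<zeta> - \<tau> \<zeta>') \<le> 2 * cmod (\<zeta> - \<zeta>')"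
    and \<tau>_shift: "\<And>\<zeta> m. \<tau> (\<zeta> + 2 * of_int m * of_real pi * \<i>) = \<tau> \<zeta> + 2 * of_int m * of_real pi * \<i>"
    by (rule affine_log_perturbation[OF a, of b]) (rule that; assumption)
  define \<rho> where "\<rho> = 3 * c + 3"
  \<comment> \<open>The last bound ensures \<open>6 * \<kappa> powr s \<le> 1\<close>.\<close>
  define \<kappa> where "\<kappa> = min (1/6) (min (1 / (8 * (c + 1))) ((1/6) powr (1/s)))"
  have \<kappa>: "0 < \<kappa>" "\<kappa> \<le> 1/6" using c by (auto simp: \<kappa>_def)
  have \<kappa>c: "\<kappa> * (c + 1) \<le> 1/8"
  proof -
    have "\<kappa> \<le> 1 / (8 * (c + 1))" by (simp add: \<kappa>_def)
    then have "\<kappa> * (c + 1) \<le> 1 / (8 * (c + 1)) * (c + 1)" using c by (intro mult_right_mono) auto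
    also have "\<dots> = 1/8" using c by (simp add: field_simps)
    finally show ?thesis .
  qed
  have \<kappa>s: "6 * \<kappa> powr s \<le> 1"
  proof -
    have "\<kappa> powr s \<le> ((1/6) powr (1/s)) powr s" using \<kappa> s by (intro powr_mono2) (auto simp: \<kappa>_def)
    also have "\<dots> = 1/6" using s by (simp add: powr_powr)
    finally show ?thesis by simp
  qed
  have M: "\<rho> + c + 1 > 0" using c by (simp add: \<rho>_def)
  obtain L1 where L1: "L1 > ln R0"
    and deriv_le: "\<And>K p. inverse_branch K \<Longrightarrow> L1 \<le> Re p \<Longrightarrow> cmod (deriv K p) \<le> \<kappa>"
    and contr: "\<And>K q q'. inverse_branch K \<Longrightarrow> L1 \<le> Re q \<Longrightarrow> L1 \<le> Re q' \<Longrightarrow> cmod (K q - K q') \<le> \<kappa> * cmod (q - q')"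
    and lin: "\<And>K p q q'. inverse_branch K \<Longrightarrow> L1 \<le> Re p \<Longrightarrow> cmod (q - p) \<le> \<rho> + c + 1 \<Longrightarrow> cmod (q' - p) \<le> \<rho> + c + 1 \<Longrightarrow>
        cmod (K q - K q' - deriv K p * (q - q')) \<le> cmod (deriv K p) / 2 * cmod (q - q')"
    by (rule inverse_branch_estimates[OF \<kappa>(1) M]) (rule that; assumption)
  define L' where "L' = max L1 (max (ln (R0 + 1)) (max (ln R) 0))"
  define L where "L = max (L' + \<rho> + 5) L2"
  have L': "L1 \<le> L'" "ln (R0 + 1) \<le> L'" "ln R \<le> L'" "0 \<le> L'" by (auto simp: L'_def)
  have L: "L' + \<rho> + 5 \<le> L" "L2 \<le> L" by (auto simp: L_def)
  have \<rho>c: "\<rho> > 0" "c + 1 \<le> \<rho>" using c by (auto simp: \<rho>_def)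
  define X where "X = {x. \<forall>n\<ge>1. exp L \<le> cmod ((g ^^ n) x)}"
  have contr_half: "cmod (K q - K q') \<le> 1/2 * cmod (q - q')"
    if "inverse_branch K" "L' \<le> Re q" "L' \<le> Re q'" for K q q'
  proof -
    have "cmod (K q - K q') \<le> \<kappa> * cmod (q - q')" by (rule contr) (use that L' in auto)
    also have "\<dots> \<le> 1/2 * cmod (q - q')" using \<kappa> by (intro mult_right_mono) auto
    finally show ?thesis .
  qed
  have f_orbit: "f (exp z) = exp (\<tau> z')" if "L \<le> Re z'" "exp z' = g (exp z)" for z z'
    using \<tau>_exp[of z'] that L a by (simp add: g_def)
  have "\<exists>\<zeta> \<eta>. shadows \<tau> L \<zeta> \<eta> \<and> exp (\<zeta> 0) = g x" if "x \<in> X" for x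
  proof -
    define \<zeta> where "\<zeta> n = Ln ((g ^^ Suc n) x)" for n
    have big: "exp L \<le> cmod ((g ^^ Suc n) x)" for n
      using that unfolding X_def by (metis (mono_tags, lifting) One_nat_def le_add1 mem_Collect_eq plus_1_eq_Suc)
    have ne: "(g ^^ Suc n) x \<noteq> 0" for n
    proof
      assume "(g ^^ Suc n) x = 0"
      then show False using big[of n] exp_gt_zero[of L] by simp
    qed
    have \<zeta>exp: "exp (\<zeta> n) = (g ^^ Suc n) x" for n using ne[of n] by (simp add: \<zeta>_def)
    have \<zeta>L: "L \<le> Re (\<zeta> n)" for n
    proof -
      have "exp L \<le> exp (Re (\<zeta> n))" using big[of n] unfolding \<zeta>exp[symmetric] by simp
      then show ?thesis by simp
    qed
    have \<zeta>f: "f (exp (\<zeta> n)) = exp (\<tau> (\<zeta> (Suc n)))" for n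
      by (rule f_orbit[OF \<zeta>L]) (simp add: \<zeta>exp)
    obtain \<eta> where "shadows \<tau> L \<zeta> \<eta>"
    proof (rule shadow_exists[of L1 \<kappa> c L \<tau> \<zeta>])
      show "L1 + c + 1 \<le> L" using L L' \<rho>c by linarith
      show "cmod (\<tau> \<zeta> - \<zeta>) \<le> c" if "L \<le> Re \<zeta>" for \<zeta> using \<tau>_near[of \<zeta>] that L by linarith
    qed (use L1 \<kappa> \<kappa>c c contr \<zeta>L \<zeta>f that in auto)
    moreover have "exp (\<zeta> 0) = g x" using \<zeta>exp[of 0] by simp
    ultimately show ?thesis by blast
  qed
  then obtain Z E where ZE: "\<And>x. x \<in> X \<Longrightarrow> shadows \<tau> L (Z x) (E x)" "\<And>x. x \<in> X \<Longrightarrow> exp (Z x 0) = g x"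
    by metis
  define \<theta> where "\<theta> x = exp (E x 0)" for x
  have E_re: "L' + 4 \<le> Re (E x n)" if "x \<in> X" for x n
  proof -
    have "L \<le> Re (Z x n)" "cmod (E x n - Z x n) \<le> 1/8" using ZE(1)[OF that] by (auto simp: shadows_def)
    then show ?thesis using abs_Re_le_cmod[of "E x n - Z x n"] L \<rho>c by simp
  qed
  have \<theta>_J: "\<theta> x \<in> julia_outside R f" if x: "x \<in> X" for x
  proof -
    have orb: "log_orbit (E x)"
      unfolding log_orbit_def
    proof
      fix n
      have "L' + 4 \<le> Re (E x (Suc n))" by (rule E_re[OF x])
      then have "E x (Suc n) \<in> H" using L1 L'(1) by (simp add: H_def)
      then show "\<exists>K. inverse_branch K \<and> E x (Suc n) \<in> H \<and> K (E x (Suc n)) = E x n"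
        using ZE(1)[OF x] unfolding shadows_def by blast
    qed
    have "R0 + 1 = exp (ln (R0 + 1))" using R0_pos by simp
    also have "\<dots> \<le> exp L'" using L' by simp
    finally have "exp L' \<ge> R0 + 1" .
    then have "\<theta> x \<in> julia_set f"
      unfolding \<theta>_def using L1 L'(1) by (intro exp_log_orbit_in_julia_set[OF _ _ contr_half orb E_re[OF x]]) auto
    moreover have "R \<le> cmod ((f ^^ n) (\<theta> x))" for n
    proof -
      have "R = exp (ln R)" using R by simp
      also have "\<dots> \<le> exp (Re (E x n))" using E_re[OF x, of n] L'(3) by simp
      finally show ?thesis unfolding \<theta>_def log_orbit_iterate[OF orb] by simp
    qed
    ultimately show ?thesis by (simp add: julia_outside_def)
  qed
  have g_cont: "continuous_on UNIV g"
    unfolding g_def by (intro continuous_intros holomorphic_on_imp_continuous_on[OF entire])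
  have local: "\<exists>U C. open U \<and> x \<in> U \<and> C > 0 \<and> (\<forall>y\<in>X \<inter> U. \<forall>z\<in>X \<inter> U. dist y z \<le> C * dist (\<theta> y) (\<theta> z) powr (1 - s))"
    if x: "x \<in> X" for x
  proof -
    define p where "p = g x"
    have p: "exp (Z x 0) = p" "p \<noteq> 0" using ZE(2)[OF x] exp_not_eq_zero[of "Z x 0"] by (simp_all add: p_def)
    have dfx: "deriv f x \<noteq> 0"
    proof -
      have re: "L \<le> Re (Z x 0)" using ZE(1)[OF x] by (auto simp: shadows_def)
      have "f x = exp (\<tau> (Z x 0))" using \<tau>_exp[of "Z x 0"] re L a p(1) by (simp add: p_def g_def)
      moreover have "\<tau> (Z x 0) \<in> H"
        using \<tau>_near[of "Z x 0"] re L L' L1 \<rho>c abs_Re_le_cmod[of "\<tau> (Z x 0) - Z x 0"] by (simp add: H_def)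
      ultimately have "f x \<notin> critical_values f" using not_sing unfolding sing_inv_def by auto
      then show ?thesis by (auto simp: critical_values_def)
    qed
    obtain r where r: "r > 0" "\<And>y z. y \<in> ball x r \<Longrightarrow> z \<in> ball x r \<Longrightarrow> cmod (deriv f x) / 2 * cmod (y - z) \<le> cmod (f y - f z)"
      by (rule holomorphic_locally_expanding[OF entire dfx]) (rule that; assumption)
    define U where "U = ball x r \<inter> g -` ball p (cmod p / 64)"
    have "open U" unfolding U_def
      by (intro open_Int open_ball open_vimage g_cont)
    moreover have "x \<in> U" using r(1) p(2) by (simp add: U_def p_def)
    define D where "D = 3 * \<rho> powr s * 3 powr (1 - s)"
    define C where "C = 2 / cmod (deriv f x) * (1 / cmod a) * (4 * cmod p * D)"
    have D: "D > 0" using \<rho>c by (simp add: D_def)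
    have "C > 0" using D dfx a p(2) by (simp add: C_def)
    moreover have "dist y z \<le> C * dist (\<theta> y) (\<theta> z) powr (1 - s)" if y: "y \<in> X \<inter> U" and z: "z \<in> X \<inter> U" for y z
    proof -
      have gy: "cmod (g y - p) < cmod p / 64" and gz: "cmod (g z - p) < cmod p / 64"
        using y z by (auto simp: U_def dist_norm norm_minus_commute)
      have gy_low: "63/64 * cmod p \<le> cmod (g y)" and gy_up: "cmod (g y) \<le> 2 * cmod p"
        using gy norm_triangle_ineq3[of "g y" p] by auto
      have gy0: "g y \<noteq> 0" using gy_low p(2) by auto
      have gz0: "g z \<noteq> 0" using gz p(2) norm_triangle_ineq3[of "g z" p] by auto
      define q where "q = g z / g y - 1"
      have "cmod q = cmod (g z - g y) / cmod (g y)"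
        using gy0 by (simp add: q_def norm_divide[symmetric] diff_divide_distrib)
      also have "\<dots> \<le> (cmod p / 32) / (63/64 * cmod p)"
        using gy gz gy_low p(2) norm_triangle_ineq4[of "g z - p" "g y - p"] by (intro frac_le) auto
      also have "\<dots> \<le> 1/30" using p(2) by simp
      finally have q: "cmod q \<le> 1/30" .
      define u where "u = Ln (1 + q)"
      have u: "cmod u \<le> 1/15" using norm_Ln_le[of q] q by (simp add: u_def)
      have eu: "exp u = g z / g y" using gy0 gz0 by (simp add: u_def q_def)
      have "exp (Z z 0) = exp (Z y 0 + u)" using ZE(2) y z eu gy0 by (simp add: exp_add)
      \<comment> \<open>The chosen logarithms of \<open>g y\<close> and \<open>g z\<close> may differ by a multiple of \<open>2 pi i\<close>; shifting the second
        shadow removes it and leaves \<open>\<theta> z\<close> unchanged.\<close>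
      then obtain m :: int where m: "Z z 0 = Z y 0 + u + 2 * of_int m * of_real pi * \<i>" by (rule exp_eqD)
      define \<zeta>' where "\<zeta>' = (Z z)(0 := Z z 0 + 2 * of_int (-m) * of_real pi * \<i>)"
      define \<eta>' where "\<eta>' = (E z)(0 := E z 0 + 2 * of_int (-m) * of_real pi * \<i>)"
      have sh': "shadows \<tau> L \<zeta>' \<eta>'" unfolding \<zeta>'_def \<eta>'_def by (rule shadows_shift[OF ZE(1)]) (use z in simp)
      have sh: "shadows \<tau> L (Z y) (E y)" using ZE(1) y by simp
      have \<zeta>'0: "\<zeta>' 0 = Z y 0 + u" by (simp add: \<zeta>'_def m)
      have "cmod (E y 0 - \<eta>' 0) \<le> cmod (E y 0 - Z y 0) + cmod u + cmod (\<eta>' 0 - \<zeta>' 0)"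
        using norm_triangle_ineq4[of "E y 0 - Z y 0" "\<eta>' 0 - \<zeta>' 0"] norm_triangle_ineq4[of "E y 0 - Z y 0 - (\<eta>' 0 - \<zeta>' 0)" u]
        by (simp add: \<zeta>'0 algebra_simps)
      moreover have "cmod (E y 0 - Z y 0) \<le> 1/8" "cmod (\<eta>' 0 - \<zeta>' 0) \<le> 1/8"
        using sh sh' unfolding shadows_def by blast+
      ultimately have near: "cmod (E y 0 - \<eta>' 0) \<le> 1/3" using u by linarith
      have "cmod (Z y 0 - \<zeta>' 0) \<le> 3 * \<rho> powr s * cmod (E y 0 - \<eta>' 0) powr (1 - s)"
      proof (rule shadow_inverse_holder[OF L1 \<kappa> \<kappa>s s c \<rho>_def deriv_le contr lin _ _ _ \<tau>_shift sh sh'])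
        show "L1 + \<rho> + 1 \<le> L" using L L' by linarith
        show "cmod (\<tau> \<zeta> - \<zeta>) \<le> c" if "L \<le> Re \<zeta>" for \<zeta> using \<tau>_near[of \<zeta>] that L by linarith
        show "cmod (\<tau> \<zeta> - \<tau> \<zeta>') \<le> 2 * cmod (\<zeta> - \<zeta>')" if "L \<le> Re \<zeta>" "L \<le> Re \<zeta>'" for \<zeta> \<zeta>'
          using \<tau>_lip[of \<zeta> \<zeta>'] that L by linarith
        show "cmod (E y 0 - \<eta>' 0) < \<rho>" using near c by (simp add: \<rho>_def)
      qed
      then have u_le: "cmod u \<le> 3 * \<rho> powr s * cmod (E y 0 - \<eta>' 0) powr (1 - s)" by (simp add: \<zeta>'0)
      have "cmod (E y 0 - \<eta>' 0) \<le> 3 * dist (\<theta> y) (\<theta> z)"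
      proof -
        have "cmod (\<eta>' 0 - E y 0) \<le> 3 * cmod (exp (\<eta>' 0 - E y 0) - 1)"
          by (rule norm_exp_minus_one_bounds) (use near in \<open>simp add: norm_minus_commute\<close>)
        also have "cmod (exp (\<eta>' 0 - E y 0) - 1) = cmod (\<theta> z - \<theta> y) / cmod (\<theta> y)"
        proof -
          have "exp (\<eta>' 0) = \<theta> z" unfolding \<eta>'_def \<theta>_def fun_upd_same by (rule exp_plus_2pin)
          then have "exp (\<eta>' 0 - E y 0) - 1 = (\<theta> z - \<theta> y) / \<theta> y"
            by (simp add: exp_diff \<theta>_def diff_divide_distrib)
          then show ?thesis by (simp only: norm_divide)
        qed
        also have "\<dots> \<le> cmod (\<theta> z - \<theta> y) / 1"
        proof (rule divide_left_mono)
          have "0 \<le> Re (E y 0)" using E_re[of y 0] y L'(4) by simp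
          then show "1 \<le> cmod (\<theta> y)" by (simp add: \<theta>_def)
        qed (auto simp: \<theta>_def)
        finally show ?thesis by (simp add: dist_norm norm_minus_commute)
      qed
      then have "cmod (E y 0 - \<eta>' 0) powr (1 - s) \<le> (3 * dist (\<theta> y) (\<theta> z)) powr (1 - s)"
        using s by (intro powr_mono2) auto
      also have "\<dots> = 3 powr (1 - s) * dist (\<theta> y) (\<theta> z) powr (1 - s)" by (simp add: powr_mult)
      finally have "cmod u \<le> 3 * \<rho> powr s * (3 powr (1 - s) * dist (\<theta> y) (\<theta> z) powr (1 - s))"
        using u_le by (meson mult_left_mono mult_nonneg_nonneg order_trans powr_ge_zero zero_le_numeral)
      then have u_le': "cmod u \<le> D * dist (\<theta> y) (\<theta> z) powr (1 - s)" by (simp add: D_def mult.assoc)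
      have "g y - g z = - g y * (exp u - 1)" using gy0 by (simp add: eu field_simps)
      then have "cmod (g y - g z) = cmod (g y) * cmod (exp u - 1)" by (simp add: norm_mult)
      also have "\<dots> \<le> (2 * cmod p) * (2 * cmod u)"
        using gy_up u by (intro mult_mono norm_exp_minus_one_bounds) auto
      also have "\<dots> \<le> 4 * cmod p * (D * dist (\<theta> y) (\<theta> z) powr (1 - s))" using u_le' by (simp add: mult_left_mono)
      finally have g_le: "cmod (g y - g z) \<le> 4 * cmod p * D * dist (\<theta> y) (\<theta> z) powr (1 - s)" by simp
      have "g y - g z = a * (f y - f z)" by (simp add: g_def algebra_simps)
      then have ga: "cmod (f y - f z) = (1 / cmod a) * cmod (g y - g z)" using a by (simp add: norm_mult)
      have "cmod (deriv f x) / 2 * cmod (y - z) \<le> cmod (f y - f z)" by (rule r(2)) (use y z in \<open>auto simp: U_def\<close>)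
      then have "cmod (y - z) \<le> 2 / cmod (deriv f x) * cmod (f y - f z)" using dfx by (simp add: field_simps)
      also have "\<dots> = 2 / cmod (deriv f x) * (1 / cmod a) * cmod (g y - g z)" by (simp add: ga)
      also have "\<dots> \<le> 2 / cmod (deriv f x) * (1 / cmod a) * (4 * cmod p * D * dist (\<theta> y) (\<theta> z) powr (1 - s))"
        using g_le by (intro mult_left_mono) auto
      finally show ?thesis by (simp add: C_def dist_norm)
    qed
    ultimately show ?thesis using \<open>x \<in> U\<close> by blast
  qed
  have "ennreal (1 - s) * hausdorff_dim X \<le> hausdorff_dim (julia_outside R f)"
    by (rule hausdorff_dim_le_locally_inverse_holder[OF _ _ local]) (use s \<theta>_J in auto)
  then show ?thesis unfolding X_def by (intro that[of "exp L"]) simp_all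
qed

end

lemma class_B_sing_inv_in_disc:
  assumes "f \<in> class_B"
  obtains R0 where "sing_inv_in_disc f R0"
proof -
  have f: "transcendental_entire f" "bounded (sing_inv f)" using assms by (auto simp: class_B_def)
  then obtain B where B: "\<And>w. w \<in> sing_inv f \<Longrightarrow> cmod w \<le> B" unfolding bounded_iff by blast
  have "sing_inv_in_disc f (max B (cmod (f 0)) + 1)"
  proof
    show "f holomorphic_on UNIV" "\<not> (\<exists>p. f = poly p)" using f(1) by (auto simp: transcendental_entire_def)
    show "cmod (f 0) < max B (cmod (f 0)) + 1" using max.cobounded2[of "cmod (f 0)" B] by linarith
    show "cmod w < max B (cmod (f 0)) + 1" if "w \<in> sing_inv f" for w
      using max.coboundedI1[OF B[OF that], of "cmod (f 0)"] by linarith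
  qed
  then show ?thesis by (rule that)
qed

lemma ennreal_le_of_mult_le:
  fixes x y :: ennreal
  assumes "\<And>s. 0 < s \<Longrightarrow> s < 1 \<Longrightarrow> ennreal (1 - s) * x \<le> y"
  shows "x \<le> y"
proof (cases x; cases y)
  fix r t assume rt: "x = ennreal r" "0 \<le> r" "y = ennreal t" "0 \<le> t"
  have "r \<le> t"
  proof (rule field_le_mult_one_interval)
    fix z :: real assume z: "0 < z" "z < 1"
    then have "ennreal z * ennreal r \<le> ennreal t" using assms[of "1 - z"] rt by simp
    then show "z * r \<le> t" using z rt by (simp add: ennreal_mult[symmetric])
  qed
  then show ?thesis using rt by (simp add: ennreal_leI)
next
  assume "x = top"
  then show ?thesis using assms[of "1/2"] by (simp add: ennreal_mult_top)
qed auto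

text \<open>
  Conjugating \<open>g\<close> by the inner affine map \<open>\<phi>\<close> gives \<open>h = a f + b\<close>, and \<open>\<phi>\<close> changes moduli and distances
  only by bounded amounts and factors.
\<close>

lemma edim_le_of_affinely_equivalent:
  assumes f: "f \<in> class_B" and equiv: "affinely_equivalent f g"
  shows "edim g \<le> edim f"
proof -
  obtain R0 where "sing_inv_in_disc f R0" by (rule class_B_sing_inv_in_disc[OF f])
  then interpret sing_inv_in_disc f R0 .
  obtain \<alpha> \<beta> \<gamma> \<delta> where \<alpha>: "\<alpha> \<noteq> 0" and \<gamma>: "\<gamma> \<noteq> 0" and eq: "(\<lambda>z. \<gamma> * z + \<delta>) \<circ> f = g \<circ> (\<lambda>z. \<alpha> * z + \<beta>)"
    using equiv unfolding affinely_equivalent_def nonconstant_affine_def by blast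
  define a where "a = \<gamma> / \<alpha>"
  define b where "b = (\<delta> - \<beta>) / \<alpha>"
  define h where "h = (\<lambda>z. a * f z + b)"
  define \<phi> where "\<phi> z = \<alpha> * z + \<beta>" for z
  define \<phi>i where "\<phi>i w = (w - \<beta>) / \<alpha>" for w
  have \<phi>\<phi>i: "\<phi> (\<phi>i w) = w" for w using \<alpha> by (simp add: \<phi>_def \<phi>i_def)
  have "g (\<phi> z) = \<phi> (h z)" for z
  proof -
    have "\<phi> (h z) = (\<alpha> * a) * f z + \<alpha> * b + \<beta>" by (simp add: \<phi>_def h_def algebra_simps)
    also have "\<dots> = \<gamma> * f z + \<delta>" using \<alpha> by (simp add: a_def b_def)
    finally show ?thesis using fun_cong[OF eq, of z] by (simp add: \<phi>_def)
  qed
  then have iter: "(g ^^ n) (\<phi> z) = \<phi> ((h ^^ n) z)" for n z by (induction n) simp_all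
  have a: "a \<noteq> 0" using \<alpha> \<gamma> by (simp add: a_def)
  have "ennreal (1 - s) * edim g \<le> edim f" if s: "0 < s" "s < 1" for s
    unfolding edim_def[of f]
  proof (rule INF_greatest)
    fix R :: real assume "R \<in> {0<..}"
    then have R: "R > 0" by simp
    obtain R' where R': "R' > 0"
      and dim: "ennreal (1 - s) * hausdorff_dim {x. \<forall>n\<ge>1. R' \<le> cmod ((h ^^ n) x)} \<le> hausdorff_dim (julia_outside R f)"
      using dim_orbits_near_infinity_le[OF a s R, of b] unfolding h_def by blast
    define R'' where "R'' = cmod \<alpha> * R' + cmod \<beta>"
    have R'': "R'' > 0" using \<alpha> R' by (simp add: R''_def add_pos_nonneg)
    have sub: "\<phi>i w \<in> {x. \<forall>n\<ge>1. R' \<le> cmod ((h ^^ n) x)}" if w: "w \<in> julia_outside R'' g" for w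
    proof (intro CollectI allI impI)
      fix n :: nat assume "1 \<le> n"
      then have "R'' \<le> cmod ((g ^^ n) (\<phi> (\<phi>i w)))" using w by (simp add: julia_outside_def \<phi>\<phi>i)
      also have "\<dots> \<le> cmod \<alpha> * cmod ((h ^^ n) (\<phi>i w)) + cmod \<beta>"
        unfolding iter using norm_triangle_ineq[of "\<alpha> * (h ^^ n) (\<phi>i w)" \<beta>] by (simp add: \<phi>_def norm_mult)
      finally show "R' \<le> cmod ((h ^^ n) (\<phi>i w))" using \<alpha> by (simp add: R''_def)
    qed
    have "ennreal 1 * hausdorff_dim (julia_outside R'' g) \<le> hausdorff_dim {x. \<forall>n\<ge>1. R' \<le> cmod ((h ^^ n) x)}"
    proof (rule hausdorff_dim_le_locally_inverse_holder[of _ \<phi>i])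
      have "dist y z \<le> cmod \<alpha> * dist (\<phi>i y) (\<phi>i z) powr 1" for y z
      proof -
        have "\<phi> (\<phi>i y) - \<phi> (\<phi>i z) = \<alpha> * (\<phi>i y - \<phi>i z)" by (simp add: \<phi>_def algebra_simps)
        then show ?thesis unfolding \<phi>\<phi>i dist_norm by (simp add: norm_mult)
      qed
      then show "\<exists>U C. open U \<and> w \<in> U \<and> C > 0 \<and> (\<forall>y\<in>julia_outside R'' g \<inter> U. \<forall>z\<in>julia_outside R'' g \<inter> U.
          dist y z \<le> C * dist (\<phi>i y) (\<phi>i z) powr 1)" for w
        using \<alpha> by (intro exI[of _ UNIV] exI[of _ "cmod \<alpha>"]) auto
    qed (use sub in auto)
    moreover have "edim g \<le> hausdorff_dim (julia_outside R'' g)"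
      unfolding edim_def using R'' by (intro INF_lower) auto
    ultimately have "edim g \<le> hausdorff_dim {x. \<forall>n\<ge>1. R' \<le> cmod ((h ^^ n) x)}" by simp
    then have "ennreal (1 - s) * edim g \<le> ennreal (1 - s) * hausdorff_dim {x. \<forall>n\<ge>1. R' \<le> cmod ((h ^^ n) x)}"
      by (rule mult_left_mono) simp
    from order_trans[OF this dim]
    show "ennreal (1 - s) * edim g \<le> hausdorff_dim (julia_outside R f)" .
  qed
  then show ?thesis by (rule ennreal_le_of_mult_le)
qed

lemma affinely_equivalent_sym:
  assumes "affinely_equivalent f g"
  shows "affinely_equivalent g f"
proof -
  obtain \<alpha> \<beta> \<gamma> \<delta> where ne: "\<alpha> \<noteq> 0" "\<gamma> \<noteq> 0" and eq: "(\<lambda>z. \<gamma> * z + \<delta>) \<circ> f = g \<circ> (\<lambda>z. \<alpha> * z + \<beta>)"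
    using assms unfolding affinely_equivalent_def nonconstant_affine_def by blast
  have "f (1 / \<alpha> * z + - \<beta> / \<alpha>) = 1 / \<gamma> * g z + - \<delta> / \<gamma>" for z
  proof -
    have "\<gamma> * f (1 / \<alpha> * z + - \<beta> / \<alpha>) + \<delta> = g (\<alpha> * (1 / \<alpha> * z + - \<beta> / \<alpha>) + \<beta>)"
      using fun_cong[OF eq, of "1 / \<alpha> * z + - \<beta> / \<alpha>"] by simp
    also have "\<alpha> * (1 / \<alpha> * z + - \<beta> / \<alpha>) + \<beta> = z" using ne by (simp add: field_simps)
    finally show ?thesis using ne by (simp add: field_simps)
  qed
  then have "(\<lambda>z. 1 / \<gamma> * z + - \<delta> / \<gamma>) \<circ> g = f \<circ> (\<lambda>z. 1 / \<alpha> * z + - \<beta> / \<alpha>)" by (simp add: fun_eq_iff)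
  moreover have "nonconstant_affine (\<lambda>z. 1 / \<alpha> * z + - \<beta> / \<alpha>)" "nonconstant_affine (\<lambda>z. 1 / \<gamma> * z + - \<delta> / \<gamma>)"
    unfolding nonconstant_affine_def using ne by (metis divide_eq_0_iff one_neq_zero)+
  ultimately show ?thesis unfolding affinely_equivalent_def by blast
qed

theorem theorem5p2:
  fixes f g :: "complex \<Rightarrow> complex"
  assumes "f \<in> class_B" and "g \<in> class_B"
    and "affinely_equivalent f g"
  shows "edim f = edim g"
proof (rule antisym)
  show "edim f \<le> edim g"
    by (rule edim_le_of_affinely_equivalent[OF assms(2) affinely_equivalent_sym[OF assms(3)]])
  show "edim g \<le> edim f"
    by (rule edim_le_of_affinely_equivalent[OF assms(1,3)])
qed

end
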